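(* Let $\mathcal{C}$ be an flCwF, let $\mathcal{A}$ be a split flCwF isofibration over $\mathcal{C}$, and let $s$ be a weak flCwF section of $\mathcal{A}$. Then $s$ preserves the fl-structure up to vertical type isomorphisms: for every context $\Gamma$ of $\mathcal{C}$, types $A:\mathsf{Ty}\,\Gamma$, $B : \mathsf{Ty}\,(\Gamma\triangleright A)$, context $\Delta$ and terms $t,u:\mathsf{Tm}\,\Gamma\,A$, there are vertical displayed type isomorphisms (in the displayed type category of $s\Gamma$) \[ s_\Sigma : s(\Sigma\,A\,B)\simeq_{\mathsf{id}}\Sigma\,(sA)\,((sB)[s_\triangleright^{-1}]),\qquad s_{\mathsf{K}} : s(\mathsf{K}\,\Delta)\simeq_{\mathsf{id}}\mathsf{K}\,(s\Delta),\qquad s_{\mathsf{Id}} : s(\mathsf{Id}\,A\,t\,u)\simeq_{\mathsf{id}}\mathsf{Id}\,(st)\,(su), \] where $\Sigma$, $\mathsf{K}$, $\mathsf{Id}$ on the right are the displayed fl-structure of $\mathcal{A}$. These isomorphisms are natural with respect to substitution (reindexing along $s\sigma$ of the isomorphism for given data equals the isomorphism for the substituted data), and $s$ preserves the term and substitution formers of the fl-structure modulo these isomorphisms (e.g. $s(\mathsf{proj}_1\,t) = \mathsf{proj}_1\,(s_\Sigma[\mathsf{id}, st])$).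
   Context: The metatheory is extensional type theory (equality reflection, UIP) with universes $\mathsf{Set}_i$. An flCwF is a category with families (contexts $\mathsf{Con}$, substitutions $\mathsf{Sub}\,\Gamma\,\Delta$ forming a category with terminal object $\bullet$, types $\mathsf{Ty}\,\Gamma$, terms $\mathsf{Tm}\,\Gamma\,A$, substitution $A[\sigma]$, $t[\sigma]$, context extension $\Gamma\triangleright A$ with $\mathsf{p}$, $\mathsf{q}$ and pairing $(\sigma,t)$) equipped with $\Sigma$-types (pairing, $\mathsf{proj}_1,\mathsf{proj}_2$), extensional identity types $\mathsf{Id}\,A\,t\,u$ (with $\mathsf{refl}$, equality reflection, UIP) and constant families $\mathsf{K}\,\Delta : \mathsf{Ty}\,\Gamma$ with a natural bijection $\mathsf{Sub}\,\Gamma\,\Delta\cong\mathsf{Tm}\,\Gamma\,(\mathsf{K}\,\Delta)$; all of this is stable under substitution. A displayed flCwF $\mathcal{A}$ over $\mathcal{C}$ is the logical-predicate (dependent) version of an flCwF over $\mathcal{C}$: it has families $\mathsf{Con}_{\mathcal{A}}\,\underline{\Gamma}$, $\mathsf{Sub}_{\mathcal{A}}\,\Gamma\,\Delta\,\underline{\sigma}$ (for $\Gamma : \mathsf{Con}_{\mathcal{A}}\,\underline\Gamma$, $\Delta:\mathsf{Con}_{\mathcal{A}}\,\underline\Delta$, $\underline\sigma:\mathsf{Sub}_{\mathcal{C}}\,\underline\Gamma\,\underline\Delta$), $\mathsf{Ty}_{\mathcal{A}}\,\Gamma\,\underline{A}$ and $\mathsf{Tm}_{\mathcal{A}}\,\Gamma\,A\,\underline{t}$,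 and for every operation of an flCwF a displayed operation lying over the corresponding base operation (e.g. $\bullet_{\mathcal{A}} : \mathsf{Con}_{\mathcal{A}}\,\bullet$, $\Gamma\triangleright A : \mathsf{Con}_{\mathcal{A}}\,(\underline\Gamma\triangleright\underline A)$, $A[\sigma] : \mathsf{Ty}_{\mathcal{A}}\,\Gamma\,(\underline A[\underline\sigma])$, displayed $\Sigma$, $\mathsf{Id}$, $\mathsf{K}$), satisfying the displayed versions of all equations. A displayed morphism is vertical if it lies over an identity. The displayed type category over $\Gamma:\mathsf{Con}_{\mathcal{A}}\,\underline\Gamma$ has objects over $\underline A$ the elements of $\mathsf{Ty}_{\mathcal{A}}\,\Gamma\,\underline A$ and morphisms over $\underline t : \mathsf{Tm}\,(\underline\Gamma\triangleright\underline A)\,(\underline B[\mathsf{p}])$ the elements of $\mathsf{Tm}_{\mathcal{A}}\,(\Gamma\triangleright A)\,(B[\mathsf{p}])\,\underline t$; a vertical type isomorphism $\simeq_{\mathsf{id}}$ is an isomorphism there lying over the identity. A split flCwF isofibration is a displayed flCwF together with iso-cleaving: for contexts, operations $\mathsf{coe} : \underline\Gamma\simeq\underline\Delta\to\mathsf{Con}_{\mathcal{A}}\,\underline\Gamma\to\mathsf{Con}_{\mathcal{A}}\,\underline\Delta$ and $\mathsf{coh}\,\underline\sigma\,\Gamma : \Gamma\simeq_{\underline\sigma}\mathsf{coe}\,\underline\sigma\,\Gamma$ (a displayed isomorphism over $\underline\sigma$), with $\mathsf{coe}$ and $\mathsf{coh}$ strictly preserving identities and composition; and similarly for types (along type isomorphisms),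 additionally commuting with substitution. A weak flCwF section $s$ of $\mathcal{A}$ consists of dependent functions $s\,\underline\Gamma:\mathsf{Con}_{\mathcal{A}}\,\underline\Gamma$, $s\,\underline\sigma : \mathsf{Sub}_{\mathcal{A}}\,(s\underline\Gamma)\,(s\underline\Delta)\,\underline\sigma$, $s\,\underline A : \mathsf{Ty}_{\mathcal{A}}\,(s\underline\Gamma)\,\underline A$, $s\,\underline t:\mathsf{Tm}_{\mathcal{A}}\,(s\underline\Gamma)\,(s\underline A)\,\underline t$ (functorial on substitutions) such that $s(\underline A[\underline\sigma]) = (s\underline A)[s\underline\sigma]$, $s(\underline t[\underline\sigma]) = (s\underline t)[s\underline\sigma]$, the unique map $\epsilon : \mathsf{Sub}_{\mathcal{A}}\,(s\bullet)\,\bullet\,\mathsf{id}$ has a vertical retraction, and each $(s\mathsf{p}, s\mathsf{q}) : \mathsf{Sub}_{\mathcal{A}}\,(s(\underline\Gamma\triangleright\underline A))\,(s\underline\Gamma\triangleright s\underline A)\,\mathsf{id}$ has a vertical inverse; these are denoted $s_\bullet$ and $s_\triangleright$. *)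

theory Defs
  imports Main
begin

(* A dependent family is represented by a set-valued function on its (raw) indices. An operation
   takes as arguments those of its type-theoretic indices that are not determined by its other
   arguments when the members of a family are disjoint; disjointness itself, which can always be
   arranged by tagging elements with their indices, is not assumed.

   The record fl_ops collects the operations only. It serves both a base flCwF and a displayed one,
   since a displayed operation takes the displayed counterparts of the same arguments. *)

record ('c, 's, 't, 'm) fl_ops =
  idn    :: "'c \<Rightarrow> 's"
  scomp  :: "'s \<Rightarrow> 's \<Rightarrow> 's"  (infixl "\<odot>\<index>" 70)
  emp    :: "'c"
  eps    :: "'c \<Rightarrow> 's"
  tysub  :: "'t \<Rightarrow> 's \<Rightarrow> 't"  ("_\<langle>_\<rangle>\<index>" [1000, 0] 1000)
  tmsub  :: "'m \<Rightarrow> 's \<Rightarrow> 'm"  ("_\<lbrace>_\<rbrace>\<index>" [1000, 0] 1000)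
  cext   :: "'c \<Rightarrow> 't \<Rightarrow> 'c"  (infixl "\<triangleright>\<index>" 65)
  pp     :: "'t \<Rightarrow> 's"
  qq     :: "'t \<Rightarrow> 'm"
  scons  :: "'t \<Rightarrow> 's \<Rightarrow> 'm \<Rightarrow> 's"
  SigTy  :: "'t \<Rightarrow> 't \<Rightarrow> 't"
  sgpair :: "'t \<Rightarrow> 't \<Rightarrow> 'm \<Rightarrow> 'm \<Rightarrow> 'm"
  proj1  :: "'t \<Rightarrow> 't \<Rightarrow> 'm \<Rightarrow> 'm"
  proj2  :: "'t \<Rightarrow> 't \<Rightarrow> 'm \<Rightarrow> 'm"
  IdTy   :: "'t \<Rightarrow> 'm \<Rightarrow> 'm \<Rightarrow> 't"
  rfl    :: "'m \<Rightarrow> 'm"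
  KTy    :: "'c \<Rightarrow> 'c \<Rightarrow> 't"
  lamK   :: "'s \<Rightarrow> 'm"
  appK   :: "'c \<Rightarrow> 'm \<Rightarrow> 's"

(* scons X A \<sigma> t is (\<sigma>, t) : Sub \<Gamma> (\<Delta> \<triangleright> A); KTy X \<Gamma> \<Delta> is K \<Delta> : Ty \<Gamma>. *)

(* (id, t) : Sub \<Gamma> (\<Gamma> \<triangleright> A) *)
definition sinst :: "('c,'s,'t,'m,'z) fl_ops_scheme \<Rightarrow> 'c \<Rightarrow> 't \<Rightarrow> 'm \<Rightarrow> 's" where
  "sinst X \<Gamma> A t = scons X A (idn X \<Gamma>) t"

(* (\<sigma> \<circ> p, q) : Sub (\<Gamma> \<triangleright> A[\<sigma>]) (\<Delta> \<triangleright> A) *)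
definition slift :: "('c,'s,'t,'m,'z) fl_ops_scheme \<Rightarrow> 't \<Rightarrow> 's \<Rightarrow> 's" where
  "slift X A \<sigma> = scons X A (\<sigma> \<odot>\<^bsub>X\<^esub> pp X (A\<langle>\<sigma>\<rangle>\<^bsub>X\<^esub>)) (qq X (A\<langle>\<sigma>\<rangle>\<^bsub>X\<^esub>))"

(* Composition g after f in the type category, for f : A \<rightarrow> B; the identity of A is qq X A. *)
definition tycomp :: "('c,'s,'t,'m,'z) fl_ops_scheme \<Rightarrow> 't \<Rightarrow> 't \<Rightarrow> 'm \<Rightarrow> 'm \<Rightarrow> 'm" where
  "tycomp X A B g f = g\<lbrace>scons X B (pp X A) f\<rbrace>\<^bsub>X\<^esub>"

(* f[id, t]: the action of a type morphism f with source A on t : Tm \<Gamma> A. *)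
definition tyact :: "('c,'s,'t,'m,'z) fl_ops_scheme \<Rightarrow> 'c \<Rightarrow> 't \<Rightarrow> 'm \<Rightarrow> 'm \<Rightarrow> 'm" where
  "tyact X \<Gamma> A f t = f\<lbrace>sinst X \<Gamma> A t\<rbrace>\<^bsub>X\<^esub>"


record ('c, 's, 't, 'm) flcwf = "('c, 's, 't, 'm) fl_ops" +
  Con :: "'c set"
  Sub :: "'c \<Rightarrow> 'c \<Rightarrow> 's set"
  Ty  :: "'c \<Rightarrow> 't set"
  Tm  :: "'c \<Rightarrow> 't \<Rightarrow> 'm set"

(* Judgements, including their presuppositions. *)

definition sub :: "('c,'s,'t,'m) flcwf \<Rightarrow> 'c \<Rightarrow> 'c \<Rightarrow> 's \<Rightarrow> bool" where
  "sub C \<Gamma> \<Delta> \<sigma> \<longleftrightarrow> \<Gamma> \<in> Con C \<and> \<Delta> \<in> Con C \<and> \<sigma> \<in> Sub C \<Gamma> \<Delta>"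

definition ty :: "('c,'s,'t,'m) flcwf \<Rightarrow> 'c \<Rightarrow> 't \<Rightarrow> bool" where
  "ty C \<Gamma> A \<longleftrightarrow> \<Gamma> \<in> Con C \<and> A \<in> Ty C \<Gamma>"

definition tm :: "('c,'s,'t,'m) flcwf \<Rightarrow> 'c \<Rightarrow> 't \<Rightarrow> 'm \<Rightarrow> bool" where
  "tm C \<Gamma> A t \<longleftrightarrow> ty C \<Gamma> A \<and> t \<in> Tm C \<Gamma> A"

locale flCwF =
  fixes C :: "('c,'s,'t,'m) flcwf" (structure)
  assumes idn_sub: "\<Gamma> \<in> Con C \<Longrightarrow> sub C \<Gamma> \<Gamma> (idn C \<Gamma>)"
    and scomp_sub: "sub C \<Delta> \<Theta> \<sigma> \<Longrightarrow> sub C \<Gamma> \<Delta> \<delta> \<Longrightarrow> sub C \<Gamma> \<Theta> (\<sigma> \<odot> \<delta>)"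
    and scomp_assoc: "sub C \<Theta> \<Xi> \<sigma> \<Longrightarrow> sub C \<Delta> \<Theta> \<delta> \<Longrightarrow> sub C \<Gamma> \<Delta> \<nu> \<Longrightarrow>
          (\<sigma> \<odot> \<delta>) \<odot> \<nu> = \<sigma> \<odot> (\<delta> \<odot> \<nu>)"
    and idn_left: "sub C \<Gamma> \<Delta> \<sigma> \<Longrightarrow> idn C \<Delta> \<odot> \<sigma> = \<sigma>"
    and idn_right: "sub C \<Gamma> \<Delta> \<sigma> \<Longrightarrow> \<sigma> \<odot> idn C \<Gamma> = \<sigma>"
    and emp_con: "emp C \<in> Con C"
    and eps_sub: "\<Gamma> \<in> Con C \<Longrightarrow> sub C \<Gamma> (emp C) (eps C \<Gamma>)"
    and eps_unique: "sub C \<Gamma> (emp C) \<sigma> \<Longrightarrow> \<sigma> = eps C \<Gamma>"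
    and tysub_ty: "ty C \<Delta> A \<Longrightarrow> sub C \<Gamma> \<Delta> \<sigma> \<Longrightarrow> ty C \<Gamma> (A\<langle>\<sigma>\<rangle>)"
    and tysub_idn: "ty C \<Gamma> A \<Longrightarrow> A\<langle>idn C \<Gamma>\<rangle> = A"
    and tysub_scomp: "ty C \<Theta> A \<Longrightarrow> sub C \<Delta> \<Theta> \<sigma> \<Longrightarrow> sub C \<Gamma> \<Delta> \<delta> \<Longrightarrow> A\<langle>\<sigma> \<odot> \<delta>\<rangle> = A\<langle>\<sigma>\<rangle>\<langle>\<delta>\<rangle>"
    and tmsub_tm: "tm C \<Delta> A t \<Longrightarrow> sub C \<Gamma> \<Delta> \<sigma> \<Longrightarrow> tm C \<Gamma> (A\<langle>\<sigma>\<rangle>) (t\<lbrace>\<sigma>\<rbrace>)"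
    and tmsub_idn: "tm C \<Gamma> A t \<Longrightarrow> t\<lbrace>idn C \<Gamma>\<rbrace> = t"
    and tmsub_scomp: "tm C \<Theta> A t \<Longrightarrow> sub C \<Delta> \<Theta> \<sigma> \<Longrightarrow> sub C \<Gamma> \<Delta> \<delta> \<Longrightarrow>
          t\<lbrace>\<sigma> \<odot> \<delta>\<rbrace> = t\<lbrace>\<sigma>\<rbrace>\<lbrace>\<delta>\<rbrace>"
    and cext_con: "ty C \<Gamma> A \<Longrightarrow> \<Gamma> \<triangleright> A \<in> Con C"
    and pp_sub: "ty C \<Gamma> A \<Longrightarrow> sub C (\<Gamma> \<triangleright> A) \<Gamma> (pp C A)"
    and qq_tm: "ty C \<Gamma> A \<Longrightarrow> tm C (\<Gamma> \<triangleright> A) (A\<langle>pp C A\<rangle>) (qq C A)"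
    and scons_sub: "sub C \<Gamma> \<Delta> \<sigma> \<Longrightarrow> ty C \<Delta> A \<Longrightarrow> tm C \<Gamma> (A\<langle>\<sigma>\<rangle>) t \<Longrightarrow>
          sub C \<Gamma> (\<Delta> \<triangleright> A) (scons C A \<sigma> t)"
    and pp_scons: "sub C \<Gamma> \<Delta> \<sigma> \<Longrightarrow> ty C \<Delta> A \<Longrightarrow> tm C \<Gamma> (A\<langle>\<sigma>\<rangle>) t \<Longrightarrow>
          pp C A \<odot> scons C A \<sigma> t = \<sigma>"
    and qq_scons: "sub C \<Gamma> \<Delta> \<sigma> \<Longrightarrow> ty C \<Delta> A \<Longrightarrow> tm C \<Gamma> (A\<langle>\<sigma>\<rangle>) t \<Longrightarrow>
          (qq C A)\<lbrace>scons C A \<sigma> t\<rbrace> = t"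
    and scons_pp_qq: "ty C \<Gamma> A \<Longrightarrow> scons C A (pp C A) (qq C A) = idn C (\<Gamma> \<triangleright> A)"
    and scons_scomp: "sub C \<Delta> \<Theta> \<sigma> \<Longrightarrow> ty C \<Theta> A \<Longrightarrow> tm C \<Delta> (A\<langle>\<sigma>\<rangle>) t \<Longrightarrow> sub C \<Gamma> \<Delta> \<delta> \<Longrightarrow>
          scons C A \<sigma> t \<odot> \<delta> = scons C A (\<sigma> \<odot> \<delta>) (t\<lbrace>\<delta>\<rbrace>)"
    and SigTy_ty: "ty C \<Gamma> A \<Longrightarrow> ty C (\<Gamma> \<triangleright> A) B \<Longrightarrow> ty C \<Gamma> (SigTy C A B)"
    and SigTy_sub: "ty C \<Delta> A \<Longrightarrow> ty C (\<Delta> \<triangleright> A) B \<Longrightarrow> sub C \<Gamma> \<Delta> \<sigma> \<Longrightarrow>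
          (SigTy C A B)\<langle>\<sigma>\<rangle> = SigTy C (A\<langle>\<sigma>\<rangle>) (B\<langle>slift C A \<sigma>\<rangle>)"
    and sgpair_tm: "ty C (\<Gamma> \<triangleright> A) B \<Longrightarrow> tm C \<Gamma> A t \<Longrightarrow> tm C \<Gamma> (B\<langle>sinst C \<Gamma> A t\<rangle>) u \<Longrightarrow>
          tm C \<Gamma> (SigTy C A B) (sgpair C A B t u)"
    and proj1_tm: "ty C \<Gamma> A \<Longrightarrow> ty C (\<Gamma> \<triangleright> A) B \<Longrightarrow> tm C \<Gamma> (SigTy C A B) t \<Longrightarrow>
          tm C \<Gamma> A (proj1 C A B t)"
    and proj2_tm: "ty C \<Gamma> A \<Longrightarrow> ty C (\<Gamma> \<triangleright> A) B \<Longrightarrow> tm C \<Gamma> (SigTy C A B) t \<Longrightarrow>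
          tm C \<Gamma> (B\<langle>sinst C \<Gamma> A (proj1 C A B t)\<rangle>) (proj2 C A B t)"
    and proj1_sgpair: "ty C (\<Gamma> \<triangleright> A) B \<Longrightarrow> tm C \<Gamma> A t \<Longrightarrow> tm C \<Gamma> (B\<langle>sinst C \<Gamma> A t\<rangle>) u \<Longrightarrow>
          proj1 C A B (sgpair C A B t u) = t"
    and proj2_sgpair: "ty C (\<Gamma> \<triangleright> A) B \<Longrightarrow> tm C \<Gamma> A t \<Longrightarrow> tm C \<Gamma> (B\<langle>sinst C \<Gamma> A t\<rangle>) u \<Longrightarrow>
          proj2 C A B (sgpair C A B t u) = u"
    and sgpair_proj: "ty C \<Gamma> A \<Longrightarrow> ty C (\<Gamma> \<triangleright> A) B \<Longrightarrow> tm C \<Gamma> (SigTy C A B) t \<Longrightarrow>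
          sgpair C A B (proj1 C A B t) (proj2 C A B t) = t"
    and sgpair_sub: "ty C (\<Delta> \<triangleright> A) B \<Longrightarrow> tm C \<Delta> A t \<Longrightarrow> tm C \<Delta> (B\<langle>sinst C \<Delta> A t\<rangle>) u \<Longrightarrow>
          sub C \<Gamma> \<Delta> \<sigma> \<Longrightarrow>
          (sgpair C A B t u)\<lbrace>\<sigma>\<rbrace> = sgpair C (A\<langle>\<sigma>\<rangle>) (B\<langle>slift C A \<sigma>\<rangle>) (t\<lbrace>\<sigma>\<rbrace>) (u\<lbrace>\<sigma>\<rbrace>)"
    and IdTy_ty: "tm C \<Gamma> A t \<Longrightarrow> tm C \<Gamma> A u \<Longrightarrow> ty C \<Gamma> (IdTy C A t u)"
    and IdTy_sub: "tm C \<Delta> A t \<Longrightarrow> tm C \<Delta> A u \<Longrightarrow> sub C \<Gamma> \<Delta> \<sigma> \<Longrightarrow>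
          (IdTy C A t u)\<langle>\<sigma>\<rangle> = IdTy C (A\<langle>\<sigma>\<rangle>) (t\<lbrace>\<sigma>\<rbrace>) (u\<lbrace>\<sigma>\<rbrace>)"
    and rfl_tm: "tm C \<Gamma> A t \<Longrightarrow> tm C \<Gamma> (IdTy C A t t) (rfl C t)"
    and rfl_sub: "tm C \<Delta> A t \<Longrightarrow> sub C \<Gamma> \<Delta> \<sigma> \<Longrightarrow> (rfl C t)\<lbrace>\<sigma>\<rbrace> = rfl C (t\<lbrace>\<sigma>\<rbrace>)"
    and Id_reflection: "tm C \<Gamma> A t \<Longrightarrow> tm C \<Gamma> A u \<Longrightarrow> tm C \<Gamma> (IdTy C A t u) e \<Longrightarrow> t = u"
    and Id_UIP: "tm C \<Gamma> A t \<Longrightarrow> tm C \<Gamma> A u \<Longrightarrow>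
          tm C \<Gamma> (IdTy C A t u) e \<Longrightarrow> tm C \<Gamma> (IdTy C A t u) e' \<Longrightarrow> e = e'"
    and KTy_ty: "\<Gamma> \<in> Con C \<Longrightarrow> \<Delta> \<in> Con C \<Longrightarrow> ty C \<Gamma> (KTy C \<Gamma> \<Delta>)"
    and KTy_sub: "\<Theta> \<in> Con C \<Longrightarrow> sub C \<Gamma> \<Delta> \<sigma> \<Longrightarrow> (KTy C \<Delta> \<Theta>)\<langle>\<sigma>\<rangle> = KTy C \<Gamma> \<Theta>"
    and lamK_tm: "sub C \<Gamma> \<Delta> \<sigma> \<Longrightarrow> tm C \<Gamma> (KTy C \<Gamma> \<Delta>) (lamK C \<sigma>)"
    and appK_sub: "\<Delta> \<in> Con C \<Longrightarrow> tm C \<Gamma> (KTy C \<Gamma> \<Delta>) t \<Longrightarrow> sub C \<Gamma> \<Delta> (appK C \<Delta> t)"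
    and appK_lamK: "sub C \<Gamma> \<Delta> \<sigma> \<Longrightarrow> appK C \<Delta> (lamK C \<sigma>) = \<sigma>"
    and lamK_appK: "\<Delta> \<in> Con C \<Longrightarrow> tm C \<Gamma> (KTy C \<Gamma> \<Delta>) t \<Longrightarrow> lamK C (appK C \<Delta> t) = t"
    and lamK_sub: "sub C \<Delta> \<Theta> \<sigma> \<Longrightarrow> sub C \<Gamma> \<Delta> \<delta> \<Longrightarrow> (lamK C \<sigma>)\<lbrace>\<delta>\<rbrace> = lamK C (\<sigma> \<odot> \<delta>)"

definition con_iso :: "('c,'s,'t,'m) flcwf \<Rightarrow> 'c \<Rightarrow> 'c \<Rightarrow> 's \<Rightarrow> bool" where
  "con_iso C \<Gamma> \<Delta> \<sigma> \<longleftrightarrow> sub C \<Gamma> \<Delta> \<sigma> \<and>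
     (\<exists>\<tau>. sub C \<Delta> \<Gamma> \<tau> \<and> \<tau> \<odot>\<^bsub>C\<^esub> \<sigma> = idn C \<Gamma> \<and> \<sigma> \<odot>\<^bsub>C\<^esub> \<tau> = idn C \<Delta>)"

definition ty_mor :: "('c,'s,'t,'m) flcwf \<Rightarrow> 'c \<Rightarrow> 't \<Rightarrow> 't \<Rightarrow> 'm \<Rightarrow> bool" where
  "ty_mor C \<Gamma> A B f \<longleftrightarrow> ty C \<Gamma> A \<and> ty C \<Gamma> B \<and> tm C (\<Gamma> \<triangleright>\<^bsub>C\<^esub> A) (B\<langle>pp C A\<rangle>\<^bsub>C\<^esub>) f"

definition ty_iso :: "('c,'s,'t,'m) flcwf \<Rightarrow> 'c \<Rightarrow> 't \<Rightarrow> 't \<Rightarrow> 'm \<Rightarrow> bool" where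
  "ty_iso C \<Gamma> A B f \<longleftrightarrow> ty_mor C \<Gamma> A B f \<and>
     (\<exists>g. ty_mor C \<Gamma> B A g \<and> tycomp C A B g f = qq C A \<and> tycomp C B A f g = qq C B)"


record ('c, 's, 't, 'm, 'dc, 'ds, 'dt, 'dm) dflcwf = "('dc, 'ds, 'dt, 'dm) fl_ops" +
  DCon :: "'c \<Rightarrow> 'dc set"
  DSub :: "'dc \<Rightarrow> 'dc \<Rightarrow> 's \<Rightarrow> 'ds set"
  DTy  :: "'dc \<Rightarrow> 't \<Rightarrow> 'dt set"
  DTm  :: "'dc \<Rightarrow> 'dt \<Rightarrow> 'm \<Rightarrow> 'dm set"

(* Displayed judgements: base data carry the subscript 0 and precede the data lying over them. *)

definition dcon ::
  "('c,'s,'t,'m) flcwf \<Rightarrow> ('c,'s,'t,'m,'dc,'ds,'dt,'dm,'z) dflcwf_scheme \<Rightarrow> 'c \<Rightarrow> 'dc \<Rightarrow> bool" where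
  "dcon C D \<Gamma>\<^sub>0 \<Gamma> \<longleftrightarrow> \<Gamma>\<^sub>0 \<in> Con C \<and> \<Gamma> \<in> DCon D \<Gamma>\<^sub>0"

definition dsub ::
  "('c,'s,'t,'m) flcwf \<Rightarrow> ('c,'s,'t,'m,'dc,'ds,'dt,'dm,'z) dflcwf_scheme \<Rightarrow>
   'c \<Rightarrow> 'c \<Rightarrow> 's \<Rightarrow> 'dc \<Rightarrow> 'dc \<Rightarrow> 'ds \<Rightarrow> bool" where
  "dsub C D \<Gamma>\<^sub>0 \<Delta>\<^sub>0 \<sigma>\<^sub>0 \<Gamma> \<Delta> \<sigma> \<longleftrightarrow>
     dcon C D \<Gamma>\<^sub>0 \<Gamma> \<and> dcon C D \<Delta>\<^sub>0 \<Delta> \<and> sub C \<Gamma>\<^sub>0 \<Delta>\<^sub>0 \<sigma>\<^sub>0 \<and> \<sigma> \<in> DSub D \<Gamma> \<Delta> \<sigma>\<^sub>0"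

definition dty ::
  "('c,'s,'t,'m) flcwf \<Rightarrow> ('c,'s,'t,'m,'dc,'ds,'dt,'dm,'z) dflcwf_scheme \<Rightarrow>
   'c \<Rightarrow> 't \<Rightarrow> 'dc \<Rightarrow> 'dt \<Rightarrow> bool" where
  "dty C D \<Gamma>\<^sub>0 A\<^sub>0 \<Gamma> A \<longleftrightarrow> dcon C D \<Gamma>\<^sub>0 \<Gamma> \<and> ty C \<Gamma>\<^sub>0 A\<^sub>0 \<and> A \<in> DTy D \<Gamma> A\<^sub>0"

definition dtm ::
  "('c,'s,'t,'m) flcwf \<Rightarrow> ('c,'s,'t,'m,'dc,'ds,'dt,'dm,'z) dflcwf_scheme \<Rightarrow>
   'c \<Rightarrow> 't \<Rightarrow> 'm \<Rightarrow> 'dc \<Rightarrow> 'dt \<Rightarrow> 'dm \<Rightarrow> bool" where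
  "dtm C D \<Gamma>\<^sub>0 A\<^sub>0 t\<^sub>0 \<Gamma> A t \<longleftrightarrow> dty C D \<Gamma>\<^sub>0 A\<^sub>0 \<Gamma> A \<and> tm C \<Gamma>\<^sub>0 A\<^sub>0 t\<^sub>0 \<and> t \<in> DTm D \<Gamma> A t\<^sub>0"

(* Operations without an explicit record index are those of D. By equality reflection, a displayed
   equation over a base equation is an equation between displayed elements. *)

locale displayed_flCwF = flCwF C
  for C :: "('c,'s,'t,'m) flcwf" +
  fixes D :: "('c,'s,'t,'m,'dc,'ds,'dt,'dm,'z) dflcwf_scheme" (structure)
  assumes d_idn_sub: "dcon C D \<Gamma>\<^sub>0 \<Gamma> \<Longrightarrow> dsub C D \<Gamma>\<^sub>0 \<Gamma>\<^sub>0 (idn C \<Gamma>\<^sub>0) \<Gamma> \<Gamma> (idn D \<Gamma>)"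
    and d_scomp_sub: "dsub C D \<Delta>\<^sub>0 \<Theta>\<^sub>0 \<sigma>\<^sub>0 \<Delta> \<Theta> \<sigma> \<Longrightarrow> dsub C D \<Gamma>\<^sub>0 \<Delta>\<^sub>0 \<delta>\<^sub>0 \<Gamma> \<Delta> \<delta> \<Longrightarrow>
          dsub C D \<Gamma>\<^sub>0 \<Theta>\<^sub>0 (\<sigma>\<^sub>0 \<odot>\<^bsub>C\<^esub> \<delta>\<^sub>0) \<Gamma> \<Theta> (\<sigma> \<odot> \<delta>)"
    and d_scomp_assoc: "dsub C D \<Theta>\<^sub>0 \<Xi>\<^sub>0 \<sigma>\<^sub>0 \<Theta> \<Xi> \<sigma> \<Longrightarrow> dsub C D \<Delta>\<^sub>0 \<Theta>\<^sub>0 \<delta>\<^sub>0 \<Delta> \<Theta> \<delta> \<Longrightarrow>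
          dsub C D \<Gamma>\<^sub>0 \<Delta>\<^sub>0 \<nu>\<^sub>0 \<Gamma> \<Delta> \<nu> \<Longrightarrow> (\<sigma> \<odot> \<delta>) \<odot> \<nu> = \<sigma> \<odot> (\<delta> \<odot> \<nu>)"
    and d_idn_left: "dsub C D \<Gamma>\<^sub>0 \<Delta>\<^sub>0 \<sigma>\<^sub>0 \<Gamma> \<Delta> \<sigma> \<Longrightarrow> idn D \<Delta> \<odot> \<sigma> = \<sigma>"
    and d_idn_right: "dsub C D \<Gamma>\<^sub>0 \<Delta>\<^sub>0 \<sigma>\<^sub>0 \<Gamma> \<Delta> \<sigma> \<Longrightarrow> \<sigma> \<odot> idn D \<Gamma> = \<sigma>"
    and d_emp_con: "dcon C D (emp C) (emp D)"
    and d_eps_sub: "dcon C D \<Gamma>\<^sub>0 \<Gamma> \<Longrightarrow> dsub C D \<Gamma>\<^sub>0 (emp C) (eps C \<Gamma>\<^sub>0) \<Gamma> (emp D) (eps D \<Gamma>)"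
    and d_eps_unique: "dsub C D \<Gamma>\<^sub>0 (emp C) \<sigma>\<^sub>0 \<Gamma> (emp D) \<sigma> \<Longrightarrow> \<sigma> = eps D \<Gamma>"
    and d_tysub_ty: "dty C D \<Delta>\<^sub>0 A\<^sub>0 \<Delta> A \<Longrightarrow> dsub C D \<Gamma>\<^sub>0 \<Delta>\<^sub>0 \<sigma>\<^sub>0 \<Gamma> \<Delta> \<sigma> \<Longrightarrow>
          dty C D \<Gamma>\<^sub>0 (A\<^sub>0\<langle>\<sigma>\<^sub>0\<rangle>\<^bsub>C\<^esub>) \<Gamma> (A\<langle>\<sigma>\<rangle>)"
    and d_tysub_idn: "dty C D \<Gamma>\<^sub>0 A\<^sub>0 \<Gamma> A \<Longrightarrow> A\<langle>idn D \<Gamma>\<rangle> = A"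
    and d_tysub_scomp: "dty C D \<Theta>\<^sub>0 A\<^sub>0 \<Theta> A \<Longrightarrow> dsub C D \<Delta>\<^sub>0 \<Theta>\<^sub>0 \<sigma>\<^sub>0 \<Delta> \<Theta> \<sigma> \<Longrightarrow>
          dsub C D \<Gamma>\<^sub>0 \<Delta>\<^sub>0 \<delta>\<^sub>0 \<Gamma> \<Delta> \<delta> \<Longrightarrow> A\<langle>\<sigma> \<odot> \<delta>\<rangle> = A\<langle>\<sigma>\<rangle>\<langle>\<delta>\<rangle>"
    and d_tmsub_tm: "dtm C D \<Delta>\<^sub>0 A\<^sub>0 t\<^sub>0 \<Delta> A t \<Longrightarrow> dsub C D \<Gamma>\<^sub>0 \<Delta>\<^sub>0 \<sigma>\<^sub>0 \<Gamma> \<Delta> \<sigma> \<Longrightarrow>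
          dtm C D \<Gamma>\<^sub>0 (A\<^sub>0\<langle>\<sigma>\<^sub>0\<rangle>\<^bsub>C\<^esub>) (t\<^sub>0\<lbrace>\<sigma>\<^sub>0\<rbrace>\<^bsub>C\<^esub>) \<Gamma> (A\<langle>\<sigma>\<rangle>) (t\<lbrace>\<sigma>\<rbrace>)"
    and d_tmsub_idn: "dtm C D \<Gamma>\<^sub>0 A\<^sub>0 t\<^sub>0 \<Gamma> A t \<Longrightarrow> t\<lbrace>idn D \<Gamma>\<rbrace> = t"
    and d_tmsub_scomp: "dtm C D \<Theta>\<^sub>0 A\<^sub>0 t\<^sub>0 \<Theta> A t \<Longrightarrow> dsub C D \<Delta>\<^sub>0 \<Theta>\<^sub>0 \<sigma>\<^sub>0 \<Delta> \<Theta> \<sigma> \<Longrightarrow>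
          dsub C D \<Gamma>\<^sub>0 \<Delta>\<^sub>0 \<delta>\<^sub>0 \<Gamma> \<Delta> \<delta> \<Longrightarrow> t\<lbrace>\<sigma> \<odot> \<delta>\<rbrace> = t\<lbrace>\<sigma>\<rbrace>\<lbrace>\<delta>\<rbrace>"
    and d_cext_con: "dty C D \<Gamma>\<^sub>0 A\<^sub>0 \<Gamma> A \<Longrightarrow> dcon C D (\<Gamma>\<^sub>0 \<triangleright>\<^bsub>C\<^esub> A\<^sub>0) (\<Gamma> \<triangleright> A)"
    and d_pp_sub: "dty C D \<Gamma>\<^sub>0 A\<^sub>0 \<Gamma> A \<Longrightarrow>
          dsub C D (\<Gamma>\<^sub>0 \<triangleright>\<^bsub>C\<^esub> A\<^sub>0) \<Gamma>\<^sub>0 (pp C A\<^sub>0) (\<Gamma> \<triangleright> A) \<Gamma> (pp D A)"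
    and d_qq_tm: "dty C D \<Gamma>\<^sub>0 A\<^sub>0 \<Gamma> A \<Longrightarrow>
          dtm C D (\<Gamma>\<^sub>0 \<triangleright>\<^bsub>C\<^esub> A\<^sub>0) (A\<^sub>0\<langle>pp C A\<^sub>0\<rangle>\<^bsub>C\<^esub>) (qq C A\<^sub>0) (\<Gamma> \<triangleright> A) (A\<langle>pp D A\<rangle>) (qq D A)"
    and d_scons_sub: "dsub C D \<Gamma>\<^sub>0 \<Delta>\<^sub>0 \<sigma>\<^sub>0 \<Gamma> \<Delta> \<sigma> \<Longrightarrow> dty C D \<Delta>\<^sub>0 A\<^sub>0 \<Delta> A \<Longrightarrow>
          dtm C D \<Gamma>\<^sub>0 (A\<^sub>0\<langle>\<sigma>\<^sub>0\<rangle>\<^bsub>C\<^esub>) t\<^sub>0 \<Gamma> (A\<langle>\<sigma>\<rangle>) t \<Longrightarrow>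
          dsub C D \<Gamma>\<^sub>0 (\<Delta>\<^sub>0 \<triangleright>\<^bsub>C\<^esub> A\<^sub>0) (scons C A\<^sub>0 \<sigma>\<^sub>0 t\<^sub>0) \<Gamma> (\<Delta> \<triangleright> A) (scons D A \<sigma> t)"
    and d_pp_scons: "dsub C D \<Gamma>\<^sub>0 \<Delta>\<^sub>0 \<sigma>\<^sub>0 \<Gamma> \<Delta> \<sigma> \<Longrightarrow> dty C D \<Delta>\<^sub>0 A\<^sub>0 \<Delta> A \<Longrightarrow>
          dtm C D \<Gamma>\<^sub>0 (A\<^sub>0\<langle>\<sigma>\<^sub>0\<rangle>\<^bsub>C\<^esub>) t\<^sub>0 \<Gamma> (A\<langle>\<sigma>\<rangle>) t \<Longrightarrow> pp D A \<odot> scons D A \<sigma> t = \<sigma>"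
    and d_qq_scons: "dsub C D \<Gamma>\<^sub>0 \<Delta>\<^sub>0 \<sigma>\<^sub>0 \<Gamma> \<Delta> \<sigma> \<Longrightarrow> dty C D \<Delta>\<^sub>0 A\<^sub>0 \<Delta> A \<Longrightarrow>
          dtm C D \<Gamma>\<^sub>0 (A\<^sub>0\<langle>\<sigma>\<^sub>0\<rangle>\<^bsub>C\<^esub>) t\<^sub>0 \<Gamma> (A\<langle>\<sigma>\<rangle>) t \<Longrightarrow> (qq D A)\<lbrace>scons D A \<sigma> t\<rbrace> = t"
    and d_scons_pp_qq: "dty C D \<Gamma>\<^sub>0 A\<^sub>0 \<Gamma> A \<Longrightarrow> scons D A (pp D A) (qq D A) = idn D (\<Gamma> \<triangleright> A)"
    and d_scons_scomp: "dsub C D \<Delta>\<^sub>0 \<Theta>\<^sub>0 \<sigma>\<^sub>0 \<Delta> \<Theta> \<sigma> \<Longrightarrow> dty C D \<Theta>\<^sub>0 A\<^sub>0 \<Theta> A \<Longrightarrow>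
          dtm C D \<Delta>\<^sub>0 (A\<^sub>0\<langle>\<sigma>\<^sub>0\<rangle>\<^bsub>C\<^esub>) t\<^sub>0 \<Delta> (A\<langle>\<sigma>\<rangle>) t \<Longrightarrow> dsub C D \<Gamma>\<^sub>0 \<Delta>\<^sub>0 \<delta>\<^sub>0 \<Gamma> \<Delta> \<delta> \<Longrightarrow>
          scons D A \<sigma> t \<odot> \<delta> = scons D A (\<sigma> \<odot> \<delta>) (t\<lbrace>\<delta>\<rbrace>)"
    and d_SigTy_ty: "dty C D \<Gamma>\<^sub>0 A\<^sub>0 \<Gamma> A \<Longrightarrow> dty C D (\<Gamma>\<^sub>0 \<triangleright>\<^bsub>C\<^esub> A\<^sub>0) B\<^sub>0 (\<Gamma> \<triangleright> A) B \<Longrightarrow>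
          dty C D \<Gamma>\<^sub>0 (SigTy C A\<^sub>0 B\<^sub>0) \<Gamma> (SigTy D A B)"
    and d_SigTy_sub: "dty C D \<Delta>\<^sub>0 A\<^sub>0 \<Delta> A \<Longrightarrow> dty C D (\<Delta>\<^sub>0 \<triangleright>\<^bsub>C\<^esub> A\<^sub>0) B\<^sub>0 (\<Delta> \<triangleright> A) B \<Longrightarrow>
          dsub C D \<Gamma>\<^sub>0 \<Delta>\<^sub>0 \<sigma>\<^sub>0 \<Gamma> \<Delta> \<sigma> \<Longrightarrow>
          (SigTy D A B)\<langle>\<sigma>\<rangle> = SigTy D (A\<langle>\<sigma>\<rangle>) (B\<langle>slift D A \<sigma>\<rangle>)"
    and d_sgpair_tm: "dty C D (\<Gamma>\<^sub>0 \<triangleright>\<^bsub>C\<^esub> A\<^sub>0) B\<^sub>0 (\<Gamma> \<triangleright> A) B \<Longrightarrow> dtm C D \<Gamma>\<^sub>0 A\<^sub>0 t\<^sub>0 \<Gamma> A t \<Longrightarrow>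
          dtm C D \<Gamma>\<^sub>0 (B\<^sub>0\<langle>sinst C \<Gamma>\<^sub>0 A\<^sub>0 t\<^sub>0\<rangle>\<^bsub>C\<^esub>) u\<^sub>0 \<Gamma> (B\<langle>sinst D \<Gamma> A t\<rangle>) u \<Longrightarrow>
          dtm C D \<Gamma>\<^sub>0 (SigTy C A\<^sub>0 B\<^sub>0) (sgpair C A\<^sub>0 B\<^sub>0 t\<^sub>0 u\<^sub>0) \<Gamma> (SigTy D A B) (sgpair D A B t u)"
    and d_proj1_tm: "dty C D \<Gamma>\<^sub>0 A\<^sub>0 \<Gamma> A \<Longrightarrow> dty C D (\<Gamma>\<^sub>0 \<triangleright>\<^bsub>C\<^esub> A\<^sub>0) B\<^sub>0 (\<Gamma> \<triangleright> A) B \<Longrightarrow>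
          dtm C D \<Gamma>\<^sub>0 (SigTy C A\<^sub>0 B\<^sub>0) t\<^sub>0 \<Gamma> (SigTy D A B) t \<Longrightarrow>
          dtm C D \<Gamma>\<^sub>0 A\<^sub>0 (proj1 C A\<^sub>0 B\<^sub>0 t\<^sub>0) \<Gamma> A (proj1 D A B t)"
    and d_proj2_tm: "dty C D \<Gamma>\<^sub>0 A\<^sub>0 \<Gamma> A \<Longrightarrow> dty C D (\<Gamma>\<^sub>0 \<triangleright>\<^bsub>C\<^esub> A\<^sub>0) B\<^sub>0 (\<Gamma> \<triangleright> A) B \<Longrightarrow>
          dtm C D \<Gamma>\<^sub>0 (SigTy C A\<^sub>0 B\<^sub>0) t\<^sub>0 \<Gamma> (SigTy D A B) t \<Longrightarrow>
          dtm C D \<Gamma>\<^sub>0 (B\<^sub>0\<langle>sinst C \<Gamma>\<^sub>0 A\<^sub>0 (proj1 C A\<^sub>0 B\<^sub>0 t\<^sub>0)\<rangle>\<^bsub>C\<^esub>) (proj2 C A\<^sub>0 B\<^sub>0 t\<^sub>0)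
            \<Gamma> (B\<langle>sinst D \<Gamma> A (proj1 D A B t)\<rangle>) (proj2 D A B t)"
    and d_proj1_sgpair: "dty C D (\<Gamma>\<^sub>0 \<triangleright>\<^bsub>C\<^esub> A\<^sub>0) B\<^sub>0 (\<Gamma> \<triangleright> A) B \<Longrightarrow> dtm C D \<Gamma>\<^sub>0 A\<^sub>0 t\<^sub>0 \<Gamma> A t \<Longrightarrow>
          dtm C D \<Gamma>\<^sub>0 (B\<^sub>0\<langle>sinst C \<Gamma>\<^sub>0 A\<^sub>0 t\<^sub>0\<rangle>\<^bsub>C\<^esub>) u\<^sub>0 \<Gamma> (B\<langle>sinst D \<Gamma> A t\<rangle>) u \<Longrightarrow>
          proj1 D A B (sgpair D A B t u) = t"
    and d_proj2_sgpair: "dty C D (\<Gamma>\<^sub>0 \<triangleright>\<^bsub>C\<^esub> A\<^sub>0) B\<^sub>0 (\<Gamma> \<triangleright> A) B \<Longrightarrow> dtm C D \<Gamma>\<^sub>0 A\<^sub>0 t\<^sub>0 \<Gamma> A t \<Longrightarrow>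
          dtm C D \<Gamma>\<^sub>0 (B\<^sub>0\<langle>sinst C \<Gamma>\<^sub>0 A\<^sub>0 t\<^sub>0\<rangle>\<^bsub>C\<^esub>) u\<^sub>0 \<Gamma> (B\<langle>sinst D \<Gamma> A t\<rangle>) u \<Longrightarrow>
          proj2 D A B (sgpair D A B t u) = u"
    and d_sgpair_proj: "dty C D \<Gamma>\<^sub>0 A\<^sub>0 \<Gamma> A \<Longrightarrow> dty C D (\<Gamma>\<^sub>0 \<triangleright>\<^bsub>C\<^esub> A\<^sub>0) B\<^sub>0 (\<Gamma> \<triangleright> A) B \<Longrightarrow>
          dtm C D \<Gamma>\<^sub>0 (SigTy C A\<^sub>0 B\<^sub>0) t\<^sub>0 \<Gamma> (SigTy D A B) t \<Longrightarrow>
          sgpair D A B (proj1 D A B t) (proj2 D A B t) = t"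
    and d_sgpair_sub: "dty C D (\<Delta>\<^sub>0 \<triangleright>\<^bsub>C\<^esub> A\<^sub>0) B\<^sub>0 (\<Delta> \<triangleright> A) B \<Longrightarrow> dtm C D \<Delta>\<^sub>0 A\<^sub>0 t\<^sub>0 \<Delta> A t \<Longrightarrow>
          dtm C D \<Delta>\<^sub>0 (B\<^sub>0\<langle>sinst C \<Delta>\<^sub>0 A\<^sub>0 t\<^sub>0\<rangle>\<^bsub>C\<^esub>) u\<^sub>0 \<Delta> (B\<langle>sinst D \<Delta> A t\<rangle>) u \<Longrightarrow>
          dsub C D \<Gamma>\<^sub>0 \<Delta>\<^sub>0 \<sigma>\<^sub>0 \<Gamma> \<Delta> \<sigma> \<Longrightarrow>
          (sgpair D A B t u)\<lbrace>\<sigma>\<rbrace> = sgpair D (A\<langle>\<sigma>\<rangle>) (B\<langle>slift D A \<sigma>\<rangle>) (t\<lbrace>\<sigma>\<rbrace>) (u\<lbrace>\<sigma>\<rbrace>)"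
    and d_IdTy_ty: "dtm C D \<Gamma>\<^sub>0 A\<^sub>0 t\<^sub>0 \<Gamma> A t \<Longrightarrow> dtm C D \<Gamma>\<^sub>0 A\<^sub>0 u\<^sub>0 \<Gamma> A u \<Longrightarrow>
          dty C D \<Gamma>\<^sub>0 (IdTy C A\<^sub>0 t\<^sub>0 u\<^sub>0) \<Gamma> (IdTy D A t u)"
    and d_IdTy_sub: "dtm C D \<Delta>\<^sub>0 A\<^sub>0 t\<^sub>0 \<Delta> A t \<Longrightarrow> dtm C D \<Delta>\<^sub>0 A\<^sub>0 u\<^sub>0 \<Delta> A u \<Longrightarrow>
          dsub C D \<Gamma>\<^sub>0 \<Delta>\<^sub>0 \<sigma>\<^sub>0 \<Gamma> \<Delta> \<sigma> \<Longrightarrow>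
          (IdTy D A t u)\<langle>\<sigma>\<rangle> = IdTy D (A\<langle>\<sigma>\<rangle>) (t\<lbrace>\<sigma>\<rbrace>) (u\<lbrace>\<sigma>\<rbrace>)"
    and d_rfl_tm: "dtm C D \<Gamma>\<^sub>0 A\<^sub>0 t\<^sub>0 \<Gamma> A t \<Longrightarrow>
          dtm C D \<Gamma>\<^sub>0 (IdTy C A\<^sub>0 t\<^sub>0 t\<^sub>0) (rfl C t\<^sub>0) \<Gamma> (IdTy D A t t) (rfl D t)"
    and d_rfl_sub: "dtm C D \<Delta>\<^sub>0 A\<^sub>0 t\<^sub>0 \<Delta> A t \<Longrightarrow> dsub C D \<Gamma>\<^sub>0 \<Delta>\<^sub>0 \<sigma>\<^sub>0 \<Gamma> \<Delta> \<sigma> \<Longrightarrow>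
          (rfl D t)\<lbrace>\<sigma>\<rbrace> = rfl D (t\<lbrace>\<sigma>\<rbrace>)"
    and d_Id_reflection: "dtm C D \<Gamma>\<^sub>0 A\<^sub>0 t\<^sub>0 \<Gamma> A t \<Longrightarrow> dtm C D \<Gamma>\<^sub>0 A\<^sub>0 u\<^sub>0 \<Gamma> A u \<Longrightarrow>
          dtm C D \<Gamma>\<^sub>0 (IdTy C A\<^sub>0 t\<^sub>0 u\<^sub>0) e\<^sub>0 \<Gamma> (IdTy D A t u) e \<Longrightarrow> t = u"
    and d_Id_UIP: "dtm C D \<Gamma>\<^sub>0 A\<^sub>0 t\<^sub>0 \<Gamma> A t \<Longrightarrow> dtm C D \<Gamma>\<^sub>0 A\<^sub>0 u\<^sub>0 \<Gamma> A u \<Longrightarrow>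
          dtm C D \<Gamma>\<^sub>0 (IdTy C A\<^sub>0 t\<^sub>0 u\<^sub>0) e\<^sub>0 \<Gamma> (IdTy D A t u) e \<Longrightarrow>
          dtm C D \<Gamma>\<^sub>0 (IdTy C A\<^sub>0 t\<^sub>0 u\<^sub>0) e'\<^sub>0 \<Gamma> (IdTy D A t u) e' \<Longrightarrow> e = e'"
    and d_KTy_ty: "dcon C D \<Gamma>\<^sub>0 \<Gamma> \<Longrightarrow> dcon C D \<Delta>\<^sub>0 \<Delta> \<Longrightarrow> dty C D \<Gamma>\<^sub>0 (KTy C \<Gamma>\<^sub>0 \<Delta>\<^sub>0) \<Gamma> (KTy D \<Gamma> \<Delta>)"
    and d_KTy_sub: "dcon C D \<Theta>\<^sub>0 \<Theta> \<Longrightarrow> dsub C D \<Gamma>\<^sub>0 \<Delta>\<^sub>0 \<sigma>\<^sub>0 \<Gamma> \<Delta> \<sigma> \<Longrightarrow>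
          (KTy D \<Delta> \<Theta>)\<langle>\<sigma>\<rangle> = KTy D \<Gamma> \<Theta>"
    and d_lamK_tm: "dsub C D \<Gamma>\<^sub>0 \<Delta>\<^sub>0 \<sigma>\<^sub>0 \<Gamma> \<Delta> \<sigma> \<Longrightarrow>
          dtm C D \<Gamma>\<^sub>0 (KTy C \<Gamma>\<^sub>0 \<Delta>\<^sub>0) (lamK C \<sigma>\<^sub>0) \<Gamma> (KTy D \<Gamma> \<Delta>) (lamK D \<sigma>)"
    and d_appK_sub: "dcon C D \<Delta>\<^sub>0 \<Delta> \<Longrightarrow> dtm C D \<Gamma>\<^sub>0 (KTy C \<Gamma>\<^sub>0 \<Delta>\<^sub>0) t\<^sub>0 \<Gamma> (KTy D \<Gamma> \<Delta>) t \<Longrightarrow>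
          dsub C D \<Gamma>\<^sub>0 \<Delta>\<^sub>0 (appK C \<Delta>\<^sub>0 t\<^sub>0) \<Gamma> \<Delta> (appK D \<Delta> t)"
    and d_appK_lamK: "dsub C D \<Gamma>\<^sub>0 \<Delta>\<^sub>0 \<sigma>\<^sub>0 \<Gamma> \<Delta> \<sigma> \<Longrightarrow> appK D \<Delta> (lamK D \<sigma>) = \<sigma>"
    and d_lamK_appK: "dcon C D \<Delta>\<^sub>0 \<Delta> \<Longrightarrow> dtm C D \<Gamma>\<^sub>0 (KTy C \<Gamma>\<^sub>0 \<Delta>\<^sub>0) t\<^sub>0 \<Gamma> (KTy D \<Gamma> \<Delta>) t \<Longrightarrow>
          lamK D (appK D \<Delta> t) = t"
    and d_lamK_sub: "dsub C D \<Delta>\<^sub>0 \<Theta>\<^sub>0 \<sigma>\<^sub>0 \<Delta> \<Theta> \<sigma> \<Longrightarrow> dsub C D \<Gamma>\<^sub>0 \<Delta>\<^sub>0 \<delta>\<^sub>0 \<Gamma> \<Delta> \<delta> \<Longrightarrow>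
          (lamK D \<sigma>)\<lbrace>\<delta>\<rbrace> = lamK D (\<sigma> \<odot> \<delta>)"

definition dcon_iso ::
  "('c,'s,'t,'m) flcwf \<Rightarrow> ('c,'s,'t,'m,'dc,'ds,'dt,'dm,'z) dflcwf_scheme \<Rightarrow>
   'c \<Rightarrow> 'c \<Rightarrow> 's \<Rightarrow> 'dc \<Rightarrow> 'dc \<Rightarrow> 'ds \<Rightarrow> bool" where
  "dcon_iso C D \<Gamma>\<^sub>0 \<Delta>\<^sub>0 \<sigma>\<^sub>0 \<Gamma> \<Delta> \<sigma> \<longleftrightarrow> dsub C D \<Gamma>\<^sub>0 \<Delta>\<^sub>0 \<sigma>\<^sub>0 \<Gamma> \<Delta> \<sigma> \<and>
     (\<exists>\<tau>\<^sub>0 \<tau>. dsub C D \<Delta>\<^sub>0 \<Gamma>\<^sub>0 \<tau>\<^sub>0 \<Delta> \<Gamma> \<tau> \<and>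
        \<tau>\<^sub>0 \<odot>\<^bsub>C\<^esub> \<sigma>\<^sub>0 = idn C \<Gamma>\<^sub>0 \<and> \<sigma>\<^sub>0 \<odot>\<^bsub>C\<^esub> \<tau>\<^sub>0 = idn C \<Delta>\<^sub>0 \<and>
        \<tau> \<odot>\<^bsub>D\<^esub> \<sigma> = idn D \<Gamma> \<and> \<sigma> \<odot>\<^bsub>D\<^esub> \<tau> = idn D \<Delta>)"

definition dty_mor ::
  "('c,'s,'t,'m) flcwf \<Rightarrow> ('c,'s,'t,'m,'dc,'ds,'dt,'dm,'z) dflcwf_scheme \<Rightarrow>
   'c \<Rightarrow> 't \<Rightarrow> 't \<Rightarrow> 'm \<Rightarrow> 'dc \<Rightarrow> 'dt \<Rightarrow> 'dt \<Rightarrow> 'dm \<Rightarrow> bool" where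
  "dty_mor C D \<Gamma>\<^sub>0 A\<^sub>0 B\<^sub>0 f\<^sub>0 \<Gamma> A B f \<longleftrightarrow> dty C D \<Gamma>\<^sub>0 A\<^sub>0 \<Gamma> A \<and> dty C D \<Gamma>\<^sub>0 B\<^sub>0 \<Gamma> B \<and>
     dtm C D (\<Gamma>\<^sub>0 \<triangleright>\<^bsub>C\<^esub> A\<^sub>0) (B\<^sub>0\<langle>pp C A\<^sub>0\<rangle>\<^bsub>C\<^esub>) f\<^sub>0 (\<Gamma> \<triangleright>\<^bsub>D\<^esub> A) (B\<langle>pp D A\<rangle>\<^bsub>D\<^esub>) f"

definition dty_iso ::
  "('c,'s,'t,'m) flcwf \<Rightarrow> ('c,'s,'t,'m,'dc,'ds,'dt,'dm,'z) dflcwf_scheme \<Rightarrow>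
   'c \<Rightarrow> 't \<Rightarrow> 't \<Rightarrow> 'm \<Rightarrow> 'dc \<Rightarrow> 'dt \<Rightarrow> 'dt \<Rightarrow> 'dm \<Rightarrow> bool" where
  "dty_iso C D \<Gamma>\<^sub>0 A\<^sub>0 B\<^sub>0 f\<^sub>0 \<Gamma> A B f \<longleftrightarrow> dty_mor C D \<Gamma>\<^sub>0 A\<^sub>0 B\<^sub>0 f\<^sub>0 \<Gamma> A B f \<and>
     (\<exists>g\<^sub>0 g. dty_mor C D \<Gamma>\<^sub>0 B\<^sub>0 A\<^sub>0 g\<^sub>0 \<Gamma> B A g \<and>
        tycomp C A\<^sub>0 B\<^sub>0 g\<^sub>0 f\<^sub>0 = qq C A\<^sub>0 \<and> tycomp C B\<^sub>0 A\<^sub>0 f\<^sub>0 g\<^sub>0 = qq C B\<^sub>0 \<and>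
        tycomp D A B g f = qq D A \<and> tycomp D B A f g = qq D B)"

definition vertical_ty_iso ::
  "('c,'s,'t,'m) flcwf \<Rightarrow> ('c,'s,'t,'m,'dc,'ds,'dt,'dm,'z) dflcwf_scheme \<Rightarrow>
   'c \<Rightarrow> 't \<Rightarrow> 'dc \<Rightarrow> 'dt \<Rightarrow> 'dt \<Rightarrow> 'dm \<Rightarrow> bool" where
  "vertical_ty_iso C D \<Gamma>\<^sub>0 A\<^sub>0 \<Gamma> A B f \<longleftrightarrow> dty_iso C D \<Gamma>\<^sub>0 A\<^sub>0 A\<^sub>0 (qq C A\<^sub>0) \<Gamma> A B f"


(* The target type is an argument of tcoe and tcoh: a type morphism f\<^sub>0 : Tm (\<Gamma>\<^sub>0 \<triangleright> A\<^sub>0) (B\<^sub>0[p]) need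
   not determine B\<^sub>0. *)

record ('c, 's, 't, 'm, 'dc, 'ds, 'dt, 'dm) iso_cleaving =
    "('c, 's, 't, 'm, 'dc, 'ds, 'dt, 'dm) dflcwf" +
  coe  :: "'s \<Rightarrow> 'dc \<Rightarrow> 'dc"
  coh  :: "'s \<Rightarrow> 'dc \<Rightarrow> 'ds"
  tcoe :: "'t \<Rightarrow> 'm \<Rightarrow> 'dt \<Rightarrow> 'dt"
  tcoh :: "'t \<Rightarrow> 'm \<Rightarrow> 'dt \<Rightarrow> 'dm"

locale split_flCwF_isofibration = displayed_flCwF C D
  for C :: "('c,'s,'t,'m) flcwf"
  and D :: "('c,'s,'t,'m,'dc,'ds,'dt,'dm,'z) iso_cleaving_scheme" (structure) +
  assumes coe_con: "con_iso C \<Gamma>\<^sub>0 \<Delta>\<^sub>0 \<sigma>\<^sub>0 \<Longrightarrow> dcon C D \<Gamma>\<^sub>0 \<Gamma> \<Longrightarrow> dcon C D \<Delta>\<^sub>0 (coe D \<sigma>\<^sub>0 \<Gamma>)"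
    and coh_iso: "con_iso C \<Gamma>\<^sub>0 \<Delta>\<^sub>0 \<sigma>\<^sub>0 \<Longrightarrow> dcon C D \<Gamma>\<^sub>0 \<Gamma> \<Longrightarrow>
          dcon_iso C D \<Gamma>\<^sub>0 \<Delta>\<^sub>0 \<sigma>\<^sub>0 \<Gamma> (coe D \<sigma>\<^sub>0 \<Gamma>) (coh D \<sigma>\<^sub>0 \<Gamma>)"
    and coe_idn: "dcon C D \<Gamma>\<^sub>0 \<Gamma> \<Longrightarrow> coe D (idn C \<Gamma>\<^sub>0) \<Gamma> = \<Gamma>"
    and coh_idn: "dcon C D \<Gamma>\<^sub>0 \<Gamma> \<Longrightarrow> coh D (idn C \<Gamma>\<^sub>0) \<Gamma> = idn D \<Gamma>"
    and coe_scomp: "con_iso C \<Delta>\<^sub>0 \<Theta>\<^sub>0 \<sigma>\<^sub>0 \<Longrightarrow> con_iso C \<Gamma>\<^sub>0 \<Delta>\<^sub>0 \<delta>\<^sub>0 \<Longrightarrow> dcon C D \<Gamma>\<^sub>0 \<Gamma> \<Longrightarrow>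
          coe D (\<sigma>\<^sub>0 \<odot>\<^bsub>C\<^esub> \<delta>\<^sub>0) \<Gamma> = coe D \<sigma>\<^sub>0 (coe D \<delta>\<^sub>0 \<Gamma>)"
    and coh_scomp: "con_iso C \<Delta>\<^sub>0 \<Theta>\<^sub>0 \<sigma>\<^sub>0 \<Longrightarrow> con_iso C \<Gamma>\<^sub>0 \<Delta>\<^sub>0 \<delta>\<^sub>0 \<Longrightarrow> dcon C D \<Gamma>\<^sub>0 \<Gamma> \<Longrightarrow>
          coh D (\<sigma>\<^sub>0 \<odot>\<^bsub>C\<^esub> \<delta>\<^sub>0) \<Gamma> = coh D \<sigma>\<^sub>0 (coe D \<delta>\<^sub>0 \<Gamma>) \<odot> coh D \<delta>\<^sub>0 \<Gamma>"
    and tcoe_ty: "ty_iso C \<Gamma>\<^sub>0 A\<^sub>0 B\<^sub>0 f\<^sub>0 \<Longrightarrow> dty C D \<Gamma>\<^sub>0 A\<^sub>0 \<Gamma> A \<Longrightarrow> dty C D \<Gamma>\<^sub>0 B\<^sub>0 \<Gamma> (tcoe D B\<^sub>0 f\<^sub>0 A)"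
    and tcoh_iso: "ty_iso C \<Gamma>\<^sub>0 A\<^sub>0 B\<^sub>0 f\<^sub>0 \<Longrightarrow> dty C D \<Gamma>\<^sub>0 A\<^sub>0 \<Gamma> A \<Longrightarrow>
          dty_iso C D \<Gamma>\<^sub>0 A\<^sub>0 B\<^sub>0 f\<^sub>0 \<Gamma> A (tcoe D B\<^sub>0 f\<^sub>0 A) (tcoh D B\<^sub>0 f\<^sub>0 A)"
    and tcoe_idn: "dty C D \<Gamma>\<^sub>0 A\<^sub>0 \<Gamma> A \<Longrightarrow> tcoe D A\<^sub>0 (qq C A\<^sub>0) A = A"
    and tcoh_idn: "dty C D \<Gamma>\<^sub>0 A\<^sub>0 \<Gamma> A \<Longrightarrow> tcoh D A\<^sub>0 (qq C A\<^sub>0) A = qq D A"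
    and tcoe_tycomp: "ty_iso C \<Gamma>\<^sub>0 A\<^sub>0 B\<^sub>0 f\<^sub>0 \<Longrightarrow> ty_iso C \<Gamma>\<^sub>0 B\<^sub>0 E\<^sub>0 g\<^sub>0 \<Longrightarrow> dty C D \<Gamma>\<^sub>0 A\<^sub>0 \<Gamma> A \<Longrightarrow>
          tcoe D E\<^sub>0 (tycomp C A\<^sub>0 B\<^sub>0 g\<^sub>0 f\<^sub>0) A = tcoe D E\<^sub>0 g\<^sub>0 (tcoe D B\<^sub>0 f\<^sub>0 A)"
    and tcoh_tycomp: "ty_iso C \<Gamma>\<^sub>0 A\<^sub>0 B\<^sub>0 f\<^sub>0 \<Longrightarrow> ty_iso C \<Gamma>\<^sub>0 B\<^sub>0 E\<^sub>0 g\<^sub>0 \<Longrightarrow> dty C D \<Gamma>\<^sub>0 A\<^sub>0 \<Gamma> A \<Longrightarrow>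
          tcoh D E\<^sub>0 (tycomp C A\<^sub>0 B\<^sub>0 g\<^sub>0 f\<^sub>0) A =
          tycomp D A (tcoe D B\<^sub>0 f\<^sub>0 A) (tcoh D E\<^sub>0 g\<^sub>0 (tcoe D B\<^sub>0 f\<^sub>0 A)) (tcoh D B\<^sub>0 f\<^sub>0 A)"
    and tcoe_sub: "ty_iso C \<Delta>\<^sub>0 A\<^sub>0 B\<^sub>0 f\<^sub>0 \<Longrightarrow> dty C D \<Delta>\<^sub>0 A\<^sub>0 \<Delta> A \<Longrightarrow> dsub C D \<Gamma>\<^sub>0 \<Delta>\<^sub>0 \<sigma>\<^sub>0 \<Gamma> \<Delta> \<sigma> \<Longrightarrow>
          (tcoe D B\<^sub>0 f\<^sub>0 A)\<langle>\<sigma>\<rangle> =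
          tcoe D (B\<^sub>0\<langle>\<sigma>\<^sub>0\<rangle>\<^bsub>C\<^esub>) (f\<^sub>0\<lbrace>slift C A\<^sub>0 \<sigma>\<^sub>0\<rbrace>\<^bsub>C\<^esub>) (A\<langle>\<sigma>\<rangle>)"
    and tcoh_sub: "ty_iso C \<Delta>\<^sub>0 A\<^sub>0 B\<^sub>0 f\<^sub>0 \<Longrightarrow> dty C D \<Delta>\<^sub>0 A\<^sub>0 \<Delta> A \<Longrightarrow> dsub C D \<Gamma>\<^sub>0 \<Delta>\<^sub>0 \<sigma>\<^sub>0 \<Gamma> \<Delta> \<sigma> \<Longrightarrow>
          (tcoh D B\<^sub>0 f\<^sub>0 A)\<lbrace>slift D A \<sigma>\<rbrace> =
          tcoh D (B\<^sub>0\<langle>\<sigma>\<^sub>0\<rangle>\<^bsub>C\<^esub>) (f\<^sub>0\<lbrace>slift C A\<^sub>0 \<sigma>\<^sub>0\<rbrace>\<^bsub>C\<^esub>) (A\<langle>\<sigma>\<rangle>)"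


(* semp is the vertical retraction of eps, and sext_inv A the vertical inverse of (s p, s q); both
   are uniquely determined by the other components. *)

record ('c, 's, 't, 'm, 'dc, 'ds, 'dt, 'dm) weak_section =
  scon     :: "'c \<Rightarrow> 'dc"
  ssub     :: "'s \<Rightarrow> 'ds"
  sty      :: "'t \<Rightarrow> 'dt"
  stm      :: "'m \<Rightarrow> 'dm"
  semp     :: "'ds"
  sext_inv :: "'t \<Rightarrow> 'ds"

locale weak_flCwF_section = displayed_flCwF C D
  for C :: "('c,'s,'t,'m) flcwf"
  and D :: "('c,'s,'t,'m,'dc,'ds,'dt,'dm,'z) dflcwf_scheme" (structure) +
  fixes S :: "('c,'s,'t,'m,'dc,'ds,'dt,'dm) weak_section"
  assumes scon_dcon: "\<Gamma> \<in> Con C \<Longrightarrow> dcon C D \<Gamma> (scon S \<Gamma>)"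
    and ssub_dsub: "sub C \<Gamma> \<Delta> \<sigma> \<Longrightarrow> dsub C D \<Gamma> \<Delta> \<sigma> (scon S \<Gamma>) (scon S \<Delta>) (ssub S \<sigma>)"
    and sty_dty: "ty C \<Gamma> A \<Longrightarrow> dty C D \<Gamma> A (scon S \<Gamma>) (sty S A)"
    and stm_dtm: "tm C \<Gamma> A t \<Longrightarrow> dtm C D \<Gamma> A t (scon S \<Gamma>) (sty S A) (stm S t)"
    and ssub_idn: "\<Gamma> \<in> Con C \<Longrightarrow> ssub S (idn C \<Gamma>) = idn D (scon S \<Gamma>)"
    and ssub_scomp: "sub C \<Delta> \<Theta> \<sigma> \<Longrightarrow> sub C \<Gamma> \<Delta> \<delta> \<Longrightarrow>
          ssub S (\<sigma> \<odot>\<^bsub>C\<^esub> \<delta>) = ssub S \<sigma> \<odot> ssub S \<delta>"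
    and sty_sub: "ty C \<Delta> A \<Longrightarrow> sub C \<Gamma> \<Delta> \<sigma> \<Longrightarrow> sty S (A\<langle>\<sigma>\<rangle>\<^bsub>C\<^esub>) = (sty S A)\<langle>ssub S \<sigma>\<rangle>"
    and stm_sub: "tm C \<Delta> A t \<Longrightarrow> sub C \<Gamma> \<Delta> \<sigma> \<Longrightarrow> stm S (t\<lbrace>\<sigma>\<rbrace>\<^bsub>C\<^esub>) = (stm S t)\<lbrace>ssub S \<sigma>\<rbrace>"
    and semp_dsub: "dsub C D (emp C) (emp C) (idn C (emp C)) (emp D) (scon S (emp C)) (semp S)"
    and semp_eps: "semp S \<odot> eps D (scon S (emp C)) = idn D (scon S (emp C))"
    and sext_inv_dsub: "ty C \<Gamma> A \<Longrightarrow>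
          dsub C D (\<Gamma> \<triangleright>\<^bsub>C\<^esub> A) (\<Gamma> \<triangleright>\<^bsub>C\<^esub> A) (idn C (\<Gamma> \<triangleright>\<^bsub>C\<^esub> A))
            (scon S \<Gamma> \<triangleright> sty S A) (scon S (\<Gamma> \<triangleright>\<^bsub>C\<^esub> A)) (sext_inv S A)"
    and sext_inv_left: "ty C \<Gamma> A \<Longrightarrow>
          sext_inv S A \<odot> scons D (sty S A) (ssub S (pp C A)) (stm S (qq C A)) =
          idn D (scon S (\<Gamma> \<triangleright>\<^bsub>C\<^esub> A))"
    and sext_inv_right: "ty C \<Gamma> A \<Longrightarrow>
          scons D (sty S A) (ssub S (pp C A)) (stm S (qq C A)) \<odot> sext_inv S A =
          idn D (scon S \<Gamma> \<triangleright> sty S A)"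

end

(* Pairing base and displayed data componentwise turns the displayed flCwF into a total flCwF, and the
   section into a morphism F from C to it that is the identity on first components; vertical
   isomorphisms are the isomorphisms of the total flCwF with first component q. F preserves
   substitution strictly, and the empty context and context extension up to isomorphism, so a term w
   in context F (\<Gamma> \<triangleright> X) becomes a type morphism out of F X when it is pulled back along
   F \<Gamma> \<triangleright> F X \<cong> F (\<Gamma> \<triangleright> X). For the three type formers w is obtained from the generic
   element q of X by eliminating it, applying F, and reintroducing in the target:
     \<Sigma>: (F (proj1 q), F (proj2 q)),   K: lamK (F (appK q)),   Id: refl (F t).
   Each w is stable under substitution because F is. The inverses are F of a generic introduction
   form, reindexed along the elimination of the generic element of the target. *)

theory Submission
  imports Defs
begin

subsection \<open>The total flCwF of a displayed flCwF\<close>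

text \<open>Working in the total flCwF trades each pair of base and displayed equations for one
  ordinary equation, and verticality becomes a separate check on first components. The obstacle is
  that F controls only what comes from C, whereas an inverse of F X -> Y lives over F \<Gamma>
  \<triangleright> Y, which is not an image context. It has to be fetched along a substitution from
  there into some image context: F (\<Gamma> \<triangleright> A \<triangleright> B) for Sigma, F
  \<Delta> for K, F \<Gamma> for Id. The type of the fetched term must then be shown to be F X
  reindexed along p. For Sigma this is a computation with projections. For K the introduction form
  sits over \<Delta> instead of \<Gamma>, and the two types are compared through the image of the
  empty context, into which any two parallel maps agree. For Id the fetched type is that of Id A t
  t. Since t and u need not be equal in C and their images agree only after reindexing, both
  identity types are exhibited as instances of one type over \<Gamma> \<triangleright> A whose
  second endpoint is a variable.\<close>

definition total ::
  "('c,'s,'t,'m) flcwf \<Rightarrow> ('c,'s,'t,'m,'dc,'ds,'dt,'dm,'z) dflcwf_scheme \<Rightarrow>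
   ('c \<times> 'dc, 's \<times> 'ds, 't \<times> 'dt, 'm \<times> 'dm) flcwf" where
  "total C D =
    \<lparr> idn = \<lambda>\<Gamma>. (idn C (fst \<Gamma>), idn D (snd \<Gamma>)),
      scomp = \<lambda>\<sigma> \<delta>. (fst \<sigma> \<odot>\<^bsub>C\<^esub> fst \<delta>, snd \<sigma> \<odot>\<^bsub>D\<^esub> snd \<delta>),
      emp = (emp C, emp D),
      eps = \<lambda>\<Gamma>. (eps C (fst \<Gamma>), eps D (snd \<Gamma>)),
      tysub = \<lambda>A \<sigma>. ((fst A)\<langle>fst \<sigma>\<rangle>\<^bsub>C\<^esub>, (snd A)\<langle>snd \<sigma>\<rangle>\<^bsub>D\<^esub>),
      tmsub = \<lambda>t \<sigma>. ((fst t)\<lbrace>fst \<sigma>\<rbrace>\<^bsub>C\<^esub>, (snd t)\<lbrace>snd \<sigma>\<rbrace>\<^bsub>D\<^esub>),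
      cext = \<lambda>\<Gamma> A. (fst \<Gamma> \<triangleright>\<^bsub>C\<^esub> fst A, snd \<Gamma> \<triangleright>\<^bsub>D\<^esub> snd A),
      pp = \<lambda>A. (pp C (fst A), pp D (snd A)),
      qq = \<lambda>A. (qq C (fst A), qq D (snd A)),
      scons = \<lambda>A \<sigma> t. (scons C (fst A) (fst \<sigma>) (fst t), scons D (snd A) (snd \<sigma>) (snd t)),
      SigTy = \<lambda>A B. (SigTy C (fst A) (fst B), SigTy D (snd A) (snd B)),
      sgpair = \<lambda>A B t u. (sgpair C (fst A) (fst B) (fst t) (fst u),
                          sgpair D (snd A) (snd B) (snd t) (snd u)),
      proj1 = \<lambda>A B t. (proj1 C (fst A) (fst B) (fst t), proj1 D (snd A) (snd B) (snd t)),
      proj2 = \<lambda>A B t. (proj2 C (fst A) (fst B) (fst t), proj2 D (snd A) (snd B) (snd t)),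
      IdTy = \<lambda>A t u. (IdTy C (fst A) (fst t) (fst u), IdTy D (snd A) (snd t) (snd u)),
      rfl = \<lambda>t. (rfl C (fst t), rfl D (snd t)),
      KTy = \<lambda>\<Gamma> \<Delta>. (KTy C (fst \<Gamma>) (fst \<Delta>), KTy D (snd \<Gamma>) (snd \<Delta>)),
      lamK = \<lambda>\<sigma>. (lamK C (fst \<sigma>), lamK D (snd \<sigma>)),
      appK = \<lambda>\<Delta> t. (appK C (fst \<Delta>) (fst t), appK D (snd \<Delta>) (snd t)),
      Con = {\<Gamma>. dcon C D (fst \<Gamma>) (snd \<Gamma>)},
      Sub = \<lambda>\<Gamma> \<Delta>. {\<sigma>. fst \<sigma> \<in> Sub C (fst \<Gamma>) (fst \<Delta>) \<and> snd \<sigma> \<in> DSub D (snd \<Gamma>) (snd \<Delta>) (fst \<sigma>)},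
      Ty = \<lambda>\<Gamma>. {A. fst A \<in> Ty C (fst \<Gamma>) \<and> snd A \<in> DTy D (snd \<Gamma>) (fst A)},
      Tm = \<lambda>\<Gamma> A. {t. fst t \<in> Tm C (fst \<Gamma>) (fst A) \<and> snd t \<in> DTm D (snd \<Gamma>) (snd A) (fst t)} \<rparr>"

lemma total_simps [simp]:
  "idn (total C D) \<Gamma> = (idn C (fst \<Gamma>), idn D (snd \<Gamma>))"
  "scomp (total C D) \<sigma> \<delta> = (fst \<sigma> \<odot>\<^bsub>C\<^esub> fst \<delta>, snd \<sigma> \<odot>\<^bsub>D\<^esub> snd \<delta>)"
  "emp (total C D) = (emp C, emp D)"
  "eps (total C D) \<Gamma> = (eps C (fst \<Gamma>), eps D (snd \<Gamma>))"
  "tysub (total C D) A \<sigma> = ((fst A)\<langle>fst \<sigma>\<rangle>\<^bsub>C\<^esub>, (snd A)\<langle>snd \<sigma>\<rangle>\<^bsub>D\<^esub>)"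
  "tmsub (total C D) t \<sigma> = ((fst t)\<lbrace>fst \<sigma>\<rbrace>\<^bsub>C\<^esub>, (snd t)\<lbrace>snd \<sigma>\<rbrace>\<^bsub>D\<^esub>)"
  "cext (total C D) \<Gamma> A = (fst \<Gamma> \<triangleright>\<^bsub>C\<^esub> fst A, snd \<Gamma> \<triangleright>\<^bsub>D\<^esub> snd A)"
  "pp (total C D) A = (pp C (fst A), pp D (snd A))"
  "qq (total C D) A = (qq C (fst A), qq D (snd A))"
  "scons (total C D) A \<sigma> t =
    (scons C (fst A) (fst \<sigma>) (fst t), scons D (snd A) (snd \<sigma>) (snd t))"
  "SigTy (total C D) A B = (SigTy C (fst A) (fst B), SigTy D (snd A) (snd B))"
  "sgpair (total C D) A B t u =
    (sgpair C (fst A) (fst B) (fst t) (fst u), sgpair D (snd A) (snd B) (snd t) (snd u))"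
  "proj1 (total C D) A B t =
    (proj1 C (fst A) (fst B) (fst t), proj1 D (snd A) (snd B) (snd t))"
  "proj2 (total C D) A B t =
    (proj2 C (fst A) (fst B) (fst t), proj2 D (snd A) (snd B) (snd t))"
  "IdTy (total C D) A t u = (IdTy C (fst A) (fst t) (fst u), IdTy D (snd A) (snd t) (snd u))"
  "rfl (total C D) t = (rfl C (fst t), rfl D (snd t))"
  "KTy (total C D) \<Gamma> \<Delta> = (KTy C (fst \<Gamma>) (fst \<Delta>), KTy D (snd \<Gamma>) (snd \<Delta>))"
  "lamK (total C D) \<sigma> = (lamK C (fst \<sigma>), lamK D (snd \<sigma>))"
  "appK (total C D) \<Delta> t = (appK C (fst \<Delta>) (fst t), appK D (snd \<Delta>) (snd t))"
  by (simp_all add: total_def)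

lemma total_derived_ops [simp]:
  "sinst (total C D) \<Gamma> A t =
    (sinst C (fst \<Gamma>) (fst A) (fst t), sinst D (snd \<Gamma>) (snd A) (snd t))"
  "slift (total C D) A \<sigma> = (slift C (fst A) (fst \<sigma>), slift D (snd A) (snd \<sigma>))"
  "tycomp (total C D) A B g f =
    (tycomp C (fst A) (fst B) (fst g) (fst f), tycomp D (snd A) (snd B) (snd g) (snd f))"
  "tyact (total C D) \<Gamma> A f t =
    (tyact C (fst \<Gamma>) (fst A) (fst f) (fst t), tyact D (snd \<Gamma>) (snd A) (snd f) (snd t))"
  by (simp_all add: sinst_def slift_def tycomp_def tyact_def)

text \<open>The raw sets \<open>Sub\<close>, \<open>Ty\<close> and \<open>Tm\<close> of
  \<open>total\<close> leave out presuppositions. These enter through \<open>sub\<close>,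
  \<open>ty\<close> and \<open>tm\<close>, and together with the pairs in \<open>Con\<close> they
  give exactly the displayed judgements.\<close>

lemma total_judgements [simp]:
  "\<Gamma> \<in> Con (total C D) \<longleftrightarrow> dcon C D (fst \<Gamma>) (snd \<Gamma>)"
  "sub (total C D) \<Gamma> \<Delta> \<sigma> \<longleftrightarrow>
    dsub C D (fst \<Gamma>) (fst \<Delta>) (fst \<sigma>) (snd \<Gamma>) (snd \<Delta>) (snd \<sigma>)"
  "ty (total C D) \<Gamma> A \<longleftrightarrow> dty C D (fst \<Gamma>) (fst A) (snd \<Gamma>) (snd A)"
  "tm (total C D) \<Gamma> A t \<longleftrightarrow> dtm C D (fst \<Gamma>) (fst A) (fst t) (snd \<Gamma>) (snd A) (snd t)"
  by (auto simp: total_def sub_def ty_def tm_def dcon_def dsub_def dty_def dtm_def)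

lemma displayed_base:
  "dcon C D \<Gamma>\<^sub>0 \<Gamma> \<Longrightarrow> \<Gamma>\<^sub>0 \<in> Con C"
  "dsub C D \<Gamma>\<^sub>0 \<Delta>\<^sub>0 \<sigma>\<^sub>0 \<Gamma> \<Delta> \<sigma> \<Longrightarrow> sub C \<Gamma>\<^sub>0 \<Delta>\<^sub>0 \<sigma>\<^sub>0"
  "dty C D \<Gamma>\<^sub>0 A\<^sub>0 \<Gamma> A \<Longrightarrow> ty C \<Gamma>\<^sub>0 A\<^sub>0"
  "dtm C D \<Gamma>\<^sub>0 A\<^sub>0 t\<^sub>0 \<Gamma> A t \<Longrightarrow> tm C \<Gamma>\<^sub>0 A\<^sub>0 t\<^sub>0"
  by (auto simp: dcon_def dsub_def dty_def dtm_def)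

text \<open>Every axiom splits by components into the base axiom and its displayed counterpart;
  \<open>displayed_base\<close> extracts the premises of the former from those of the
  latter.\<close>

lemma (in displayed_flCwF) flCwF_total: "flCwF (total C D)"
  apply unfold_locales
  subgoal by (simp add: prod_eq_iff) (meson idn_sub d_idn_sub displayed_base)
  subgoal by (simp add: prod_eq_iff) (meson scomp_sub d_scomp_sub displayed_base)
  subgoal by (simp add: prod_eq_iff) (meson scomp_assoc d_scomp_assoc displayed_base)
  subgoal by (simp add: prod_eq_iff) (meson idn_left d_idn_left displayed_base)
  subgoal by (simp add: prod_eq_iff) (meson idn_right d_idn_right displayed_base)
  subgoal by (simp add: prod_eq_iff) (meson emp_con d_emp_con displayed_base)
  subgoal by (simp add: prod_eq_iff) (meson eps_sub d_eps_sub displayed_base)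
  subgoal by (simp add: prod_eq_iff) (meson eps_unique d_eps_unique displayed_base)
  subgoal by (simp add: prod_eq_iff) (meson tysub_ty d_tysub_ty displayed_base)
  subgoal by (simp add: prod_eq_iff) (meson tysub_idn d_tysub_idn displayed_base)
  subgoal by (simp add: prod_eq_iff) (meson tysub_scomp d_tysub_scomp displayed_base)
  subgoal by (simp add: prod_eq_iff) (meson tmsub_tm d_tmsub_tm displayed_base)
  subgoal by (simp add: prod_eq_iff) (meson tmsub_idn d_tmsub_idn displayed_base)
  subgoal by (simp add: prod_eq_iff) (meson tmsub_scomp d_tmsub_scomp displayed_base)
  subgoal by (simp add: prod_eq_iff) (meson cext_con d_cext_con displayed_base)
  subgoal by (simp add: prod_eq_iff) (meson pp_sub d_pp_sub displayed_base)
  subgoal by (simp add: prod_eq_iff) (meson qq_tm d_qq_tm displayed_base)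
  subgoal by (simp add: prod_eq_iff) (meson scons_sub d_scons_sub displayed_base)
  subgoal by (simp add: prod_eq_iff) (meson pp_scons d_pp_scons displayed_base)
  subgoal by (simp add: prod_eq_iff) (meson qq_scons d_qq_scons displayed_base)
  subgoal by (simp add: prod_eq_iff) (meson scons_pp_qq d_scons_pp_qq displayed_base)
  subgoal by (simp add: prod_eq_iff) (meson scons_scomp d_scons_scomp displayed_base)
  subgoal by (simp add: prod_eq_iff) (meson SigTy_ty d_SigTy_ty displayed_base)
  subgoal by (simp add: prod_eq_iff) (meson SigTy_sub d_SigTy_sub displayed_base)
  subgoal by (simp add: prod_eq_iff) (meson sgpair_tm d_sgpair_tm displayed_base)
  subgoal by (simp add: prod_eq_iff) (meson proj1_tm d_proj1_tm displayed_base)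
  subgoal by (simp add: prod_eq_iff) (meson proj2_tm d_proj2_tm displayed_base)
  subgoal by (simp add: prod_eq_iff) (meson proj1_sgpair d_proj1_sgpair displayed_base)
  subgoal by (simp add: prod_eq_iff) (meson proj2_sgpair d_proj2_sgpair displayed_base)
  subgoal by (simp add: prod_eq_iff) (meson sgpair_proj d_sgpair_proj displayed_base)
  subgoal by (simp add: prod_eq_iff) (meson sgpair_sub d_sgpair_sub displayed_base)
  subgoal by (simp add: prod_eq_iff) (meson IdTy_ty d_IdTy_ty displayed_base)
  subgoal by (simp add: prod_eq_iff) (meson IdTy_sub d_IdTy_sub displayed_base)
  subgoal by (simp add: prod_eq_iff) (meson rfl_tm d_rfl_tm displayed_base)
  subgoal by (simp add: prod_eq_iff) (meson rfl_sub d_rfl_sub displayed_base)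
  subgoal by (simp add: prod_eq_iff) (meson Id_reflection d_Id_reflection displayed_base)
  subgoal by (simp add: prod_eq_iff) (meson Id_UIP d_Id_UIP displayed_base)
  subgoal by (simp add: prod_eq_iff) (meson KTy_ty d_KTy_ty displayed_base)
  subgoal by (simp add: prod_eq_iff) (meson KTy_sub d_KTy_sub displayed_base)
  subgoal by (simp add: prod_eq_iff) (meson lamK_tm d_lamK_tm displayed_base)
  subgoal by (simp add: prod_eq_iff) (meson appK_sub d_appK_sub displayed_base)
  subgoal by (simp add: prod_eq_iff) (meson appK_lamK d_appK_lamK displayed_base)
  subgoal by (simp add: prod_eq_iff) (meson lamK_appK d_lamK_appK displayed_base)
  subgoal by (simp add: prod_eq_iff) (meson lamK_sub d_lamK_sub displayed_base)
  done

subsection \<open>Substitution calculus\<close>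

context flCwF
begin

lemma tm_ty: "tm C \<Gamma> A t \<Longrightarrow> ty C \<Gamma> A"
  by (simp add: tm_def)

lemma ty_con: "ty C \<Gamma> A \<Longrightarrow> \<Gamma> \<in> Con C"
  by (simp add: ty_def)

lemma sub_con: "sub C \<Gamma> \<Delta> \<sigma> \<Longrightarrow> \<Gamma> \<in> Con C" "sub C \<Gamma> \<Delta> \<sigma> \<Longrightarrow> \<Delta> \<in> Con C"
  by (simp_all add: sub_def)

lemma scons_eta:
  "ty C \<Delta> A \<Longrightarrow> sub C \<Gamma> (\<Delta> \<triangleright> A) \<rho> \<Longrightarrow> scons C A (pp C A \<odot> \<rho>) ((qq C A)\<lbrace>\<rho>\<rbrace>) = \<rho>"
  using scons_scomp[OF pp_sub _ qq_tm] by (simp add: scons_pp_qq idn_left)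

lemma sinst_tm: "tm C \<Gamma> A t \<Longrightarrow> tm C \<Gamma> (A\<langle>idn C \<Gamma>\<rangle>) t"
  by (simp add: tysub_idn tm_ty)

lemma sinst_sub: "tm C \<Gamma> A t \<Longrightarrow> sub C \<Gamma> (\<Gamma> \<triangleright> A) (sinst C \<Gamma> A t)"
  unfolding sinst_def by (rule scons_sub[OF idn_sub[OF ty_con[OF tm_ty]] tm_ty sinst_tm])

lemma pp_sinst: "tm C \<Gamma> A t \<Longrightarrow> pp C A \<odot> sinst C \<Gamma> A t = idn C \<Gamma>"
  unfolding sinst_def by (rule pp_scons[OF idn_sub[OF ty_con[OF tm_ty]] tm_ty sinst_tm])

lemma qq_sinst: "tm C \<Gamma> A t \<Longrightarrow> (qq C A)\<lbrace>sinst C \<Gamma> A t\<rbrace> = t"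
  unfolding sinst_def by (rule qq_scons[OF idn_sub[OF ty_con[OF tm_ty]] tm_ty sinst_tm])

text \<open>Pairing onto a composite demands the type in this form rather than as an iterated
  substitution.\<close>

lemma tmsub_scomp_tm:
  "tm C \<Delta> (A\<langle>\<sigma>\<rangle>) t \<Longrightarrow> ty C \<Theta> A \<Longrightarrow> sub C \<Delta> \<Theta> \<sigma> \<Longrightarrow> sub C \<Gamma> \<Delta> \<delta> \<Longrightarrow>
    tm C \<Gamma> (A\<langle>\<sigma> \<odot> \<delta>\<rangle>) (t\<lbrace>\<delta>\<rbrace>)"
  using tmsub_tm[of \<Delta> "A\<langle>\<sigma>\<rangle>" t \<Gamma> \<delta>] by (simp add: tysub_scomp)

lemma slift_tm:
  assumes "ty C \<Delta> A" "sub C \<Gamma> \<Delta> \<sigma>"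
  shows "sub C (\<Gamma> \<triangleright> A\<langle>\<sigma>\<rangle>) \<Delta> (\<sigma> \<odot> pp C (A\<langle>\<sigma>\<rangle>))"
    and "tm C (\<Gamma> \<triangleright> A\<langle>\<sigma>\<rangle>) (A\<langle>\<sigma> \<odot> pp C (A\<langle>\<sigma>\<rangle>)\<rangle>) (qq C (A\<langle>\<sigma>\<rangle>))"
  using scomp_sub[OF assms(2) pp_sub[OF tysub_ty[OF assms]]] qq_tm[OF tysub_ty[OF assms]]
  by (simp_all add: tysub_scomp[OF assms pp_sub[OF tysub_ty[OF assms]]])

lemma slift_sub:
  "ty C \<Delta> A \<Longrightarrow> sub C \<Gamma> \<Delta> \<sigma> \<Longrightarrow> sub C (\<Gamma> \<triangleright> A\<langle>\<sigma>\<rangle>) (\<Delta> \<triangleright> A) (slift C A \<sigma>)"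
  unfolding slift_def by (rule scons_sub[OF slift_tm(1) _ slift_tm(2)])

lemma pp_slift:
  "ty C \<Delta> A \<Longrightarrow> sub C \<Gamma> \<Delta> \<sigma> \<Longrightarrow> pp C A \<odot> slift C A \<sigma> = \<sigma> \<odot> pp C (A\<langle>\<sigma>\<rangle>)"
  unfolding slift_def by (rule pp_scons[OF slift_tm(1) _ slift_tm(2)])

lemma qq_slift:
  "ty C \<Delta> A \<Longrightarrow> sub C \<Gamma> \<Delta> \<sigma> \<Longrightarrow> (qq C A)\<lbrace>slift C A \<sigma>\<rbrace> = qq C (A\<langle>\<sigma>\<rangle>)"
  unfolding slift_def by (rule qq_scons[OF slift_tm(1) _ slift_tm(2)])

text \<open>The composition laws of \<open>slift\<close> with another \<open>slift\<close> and with
  \<open>sinst\<close> are both instances of this one.\<close>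

lemma slift_scons:
  assumes "ty C \<Theta> A" "sub C \<Delta> \<Theta> \<sigma>" "sub C \<Gamma> \<Delta> \<delta>" "tm C \<Gamma> (A\<langle>\<sigma>\<rangle>\<langle>\<delta>\<rangle>) t"
  shows "slift C A \<sigma> \<odot> scons C (A\<langle>\<sigma>\<rangle>) \<delta> t = scons C A (\<sigma> \<odot> \<delta>) t"
proof -
  note A\<sigma> = tysub_ty[OF assms(1,2)]
  note s = scons_sub[OF assms(3) A\<sigma> assms(4)]
  have "slift C A \<sigma> \<odot> scons C (A\<langle>\<sigma>\<rangle>) \<delta> t =
      scons C A ((\<sigma> \<odot> pp C (A\<langle>\<sigma>\<rangle>)) \<odot> scons C (A\<langle>\<sigma>\<rangle>) \<delta> t) ((qq C (A\<langle>\<sigma>\<rangle>))\<lbrace>scons C (A\<langle>\<sigma>\<rangle>) \<delta> t\<rbrace>)"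
    unfolding slift_def
    by (rule scons_scomp[OF slift_tm(1)[OF assms(1,2)] assms(1) slift_tm(2)[OF assms(1,2)] s])
  then show ?thesis
    by (simp add: scomp_assoc[OF assms(2) pp_sub[OF A\<sigma>] s] pp_scons[OF assms(3) A\<sigma> assms(4)]
        qq_scons[OF assms(3) A\<sigma> assms(4)])
qed

text \<open>Naturality of one direction of a bijection yields naturality of its inverse.\<close>

lemma appK_scomp:
  "\<Theta> \<in> Con C \<Longrightarrow> tm C \<Delta> (KTy C \<Delta> \<Theta>) t \<Longrightarrow> sub C \<Gamma> \<Delta> \<sigma> \<Longrightarrow>
    appK C \<Theta> (t\<lbrace>\<sigma>\<rbrace>) = appK C \<Theta> t \<odot> \<sigma>"
  using lamK_sub[OF appK_sub, of \<Theta> \<Delta> t \<Gamma> \<sigma>] appK_lamK[OF scomp_sub[OF appK_sub], of \<Theta> \<Delta> t \<Gamma> \<sigma>]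
  by (simp add: lamK_appK)

lemma eps_scomp: "sub C \<Gamma> \<Delta> \<sigma> \<Longrightarrow> eps C \<Delta> \<odot> \<sigma> = eps C \<Gamma>"
  by (rule eps_unique[OF scomp_sub[OF eps_sub[OF sub_con(2)]]])

end

text \<open>\<open>\<Sigma>\<close>-types relative to a substitution \<open>\<sigma>\<close> into the context of \<open>A\<close> and \<open>B\<close>: in this form the
  operations commute with reindexing without changing \<open>A\<close> and \<open>B\<close>.\<close>

definition spair :: "('c,'s,'t,'m,'z) fl_ops_scheme \<Rightarrow> 't \<Rightarrow> 't \<Rightarrow> 's \<Rightarrow> 'm \<Rightarrow> 'm \<Rightarrow> 'm" where
  "spair X A B \<sigma> t u = sgpair X (A\<langle>\<sigma>\<rangle>\<^bsub>X\<^esub>) (B\<langle>slift X A \<sigma>\<rangle>\<^bsub>X\<^esub>) t u"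

definition sproj1 :: "('c,'s,'t,'m,'z) fl_ops_scheme \<Rightarrow> 't \<Rightarrow> 't \<Rightarrow> 's \<Rightarrow> 'm \<Rightarrow> 'm" where
  "sproj1 X A B \<sigma> t = proj1 X (A\<langle>\<sigma>\<rangle>\<^bsub>X\<^esub>) (B\<langle>slift X A \<sigma>\<rangle>\<^bsub>X\<^esub>) t"

definition sproj2 :: "('c,'s,'t,'m,'z) fl_ops_scheme \<Rightarrow> 't \<Rightarrow> 't \<Rightarrow> 's \<Rightarrow> 'm \<Rightarrow> 'm" where
  "sproj2 X A B \<sigma> t = proj2 X (A\<langle>\<sigma>\<rangle>\<^bsub>X\<^esub>) (B\<langle>slift X A \<sigma>\<rangle>\<^bsub>X\<^esub>) t"

text \<open>Elimination of Sigma packaged as a substitution, so that taking a term apart becomes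
  reindexing of data over \<Gamma> \<triangleright> A \<triangleright> B.\<close>

definition unpair :: "('c,'s,'t,'m,'z) fl_ops_scheme \<Rightarrow> 't \<Rightarrow> 't \<Rightarrow> 's \<Rightarrow> 'm \<Rightarrow> 's" where
  "unpair X A B \<sigma> t = scons X B (scons X A \<sigma> (sproj1 X A B \<sigma> t)) (sproj2 X A B \<sigma> t)"

text \<open>The generic pair, built from the two variables of the doubly extended context. Every
  term of a Sigma-type is its reindexing along \<open>unpair\<close>.\<close>

definition var_pair :: "('c,'s,'t,'m,'z) fl_ops_scheme \<Rightarrow> 't \<Rightarrow> 't \<Rightarrow> 'm" where
  "var_pair X A B = spair X A B (pp X A \<odot>\<^bsub>X\<^esub> pp X B) ((qq X A)\<lbrace>pp X B\<rbrace>\<^bsub>X\<^esub>) (qq X B)"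

context flCwF
begin

lemma slift_idn: "ty C \<Gamma> A \<Longrightarrow> slift C A (idn C \<Gamma>) = idn C (\<Gamma> \<triangleright> A)"
  by (simp add: slift_def tysub_idn idn_left[OF pp_sub] scons_pp_qq)

lemma slift_slift:
  assumes "ty C \<Theta> A" "sub C \<Delta> \<Theta> \<sigma>" "sub C \<Gamma> \<Delta> \<delta>"
  shows "slift C A \<sigma> \<odot> slift C (A\<langle>\<sigma>\<rangle>) \<delta> = slift C A (\<sigma> \<odot> \<delta>)"
proof -
  note A\<sigma> = tysub_ty[OF assms(1,2)]
  note l = slift_tm[OF A\<sigma> assms(3)]
  have q: "tm C (\<Gamma> \<triangleright> A\<langle>\<sigma>\<rangle>\<langle>\<delta>\<rangle>) (A\<langle>\<sigma>\<rangle>\<langle>\<delta> \<odot> pp C (A\<langle>\<sigma>\<rangle>\<langle>\<delta>\<rangle>)\<rangle>) (qq C (A\<langle>\<sigma>\<rangle>\<langle>\<delta>\<rangle>))"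
    by (rule l(2))
  show ?thesis
    using slift_scons[OF assms(1,2) l(1) q]
      scomp_assoc[OF assms(2,3) pp_sub[OF tysub_ty[OF A\<sigma> assms(3)]]]
    by (simp add: slift_def[of C "A\<langle>\<sigma>\<rangle>"] slift_def[of C A "\<sigma> \<odot> \<delta>"] tysub_scomp[OF assms])
qed

lemma slift_sinst_scons:
  assumes "sub C \<Gamma> \<Delta> \<sigma>" "ty C \<Delta> A" "tm C \<Gamma> (A\<langle>\<sigma>\<rangle>) t"
  shows "slift C A \<sigma> \<odot> sinst C \<Gamma> (A\<langle>\<sigma>\<rangle>) t = scons C A \<sigma> t"
  using slift_scons[OF assms(2,1) idn_sub[OF sub_con(1)[OF assms(1)]] sinst_tm[OF assms(3)]]
  by (simp add: sinst_def idn_right[OF assms(1)])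

context
  fixes \<Gamma> A B
  assumes A: "ty C \<Gamma> A" and B: "ty C (\<Gamma> \<triangleright> A) B"
begin

lemma snd_ty_slift: "sub C \<Xi> \<Gamma> \<sigma> \<Longrightarrow> ty C (\<Xi> \<triangleright> A\<langle>\<sigma>\<rangle>) (B\<langle>slift C A \<sigma>\<rangle>)"
  by (rule tysub_ty[OF B slift_sub[OF A]])

text \<open>Second components of relative pairs are typed over the substitution (\<sigma>, t); this
  matches that type with the one \<open>sgpair\<close> expects.\<close>

lemma snd_ty_sinst:
  "sub C \<Xi> \<Gamma> \<sigma> \<Longrightarrow> tm C \<Xi> (A\<langle>\<sigma>\<rangle>) t \<Longrightarrow>
    B\<langle>slift C A \<sigma>\<rangle>\<langle>sinst C \<Xi> (A\<langle>\<sigma>\<rangle>) t\<rangle> = B\<langle>scons C A \<sigma> t\<rangle>"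
  using tysub_scomp[OF B slift_sub[OF A] sinst_sub, of \<Xi> \<sigma> t] slift_sinst_scons[OF _ A, of \<Xi> \<sigma> t]
  by simp

lemma snd_ty_slift_slift:
  "sub C \<Xi> \<Gamma> \<sigma> \<Longrightarrow> sub C \<Xi>' \<Xi> \<delta> \<Longrightarrow>
    B\<langle>slift C A \<sigma>\<rangle>\<langle>slift C (A\<langle>\<sigma>\<rangle>) \<delta>\<rangle> = B\<langle>slift C A (\<sigma> \<odot> \<delta>)\<rangle>"
  using tysub_scomp[OF B slift_sub[OF A] slift_sub[OF tysub_ty[OF A]], of \<Xi> \<sigma> \<Xi>' \<delta>]
  by (simp add: slift_slift[OF A])

lemma scons_scomp_tm:
  "sub C \<Xi> \<Gamma> \<sigma> \<Longrightarrow> tm C \<Xi> (A\<langle>\<sigma>\<rangle>) t \<Longrightarrow> tm C \<Xi> (B\<langle>scons C A \<sigma> t\<rangle>) u \<Longrightarrow> sub C \<Xi>' \<Xi> \<delta> \<Longrightarrow>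
    tm C \<Xi>' (B\<langle>scons C A (\<sigma> \<odot> \<delta>) (t\<lbrace>\<delta>\<rbrace>)\<rangle>) (u\<lbrace>\<delta>\<rbrace>)"
  using tmsub_scomp_tm[OF _ B scons_sub[OF _ A]] by (simp add: scons_scomp[OF _ A])

lemma spair_tm:
  "sub C \<Xi> \<Gamma> \<sigma> \<Longrightarrow> tm C \<Xi> (A\<langle>\<sigma>\<rangle>) t \<Longrightarrow> tm C \<Xi> (B\<langle>scons C A \<sigma> t\<rangle>) u \<Longrightarrow>
    tm C \<Xi> ((SigTy C A B)\<langle>\<sigma>\<rangle>) (spair C A B \<sigma> t u)"
  unfolding spair_def SigTy_sub[OF A B]
  by (rule sgpair_tm[OF snd_ty_slift]) (simp_all add: snd_ty_sinst)

lemma spair_sub: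
  assumes "sub C \<Xi> \<Gamma> \<sigma>" "tm C \<Xi> (A\<langle>\<sigma>\<rangle>) t" "tm C \<Xi> (B\<langle>scons C A \<sigma> t\<rangle>) u" "sub C \<Xi>' \<Xi> \<delta>"
  shows "(spair C A B \<sigma> t u)\<lbrace>\<delta>\<rbrace> = spair C A B (\<sigma> \<odot> \<delta>) (t\<lbrace>\<delta>\<rbrace>) (u\<lbrace>\<delta>\<rbrace>)"
  using sgpair_sub[OF snd_ty_slift[OF assms(1)] assms(2) _ assms(4), of u] assms
  by (simp add: spair_def snd_ty_sinst snd_ty_slift_slift tysub_scomp[OF A])

lemma sproj_spair:
  assumes "sub C \<Xi> \<Gamma> \<sigma>" "tm C \<Xi> (A\<langle>\<sigma>\<rangle>) t" "tm C \<Xi> (B\<langle>scons C A \<sigma> t\<rangle>) u"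
  shows "sproj1 C A B \<sigma> (spair C A B \<sigma> t u) = t" "sproj2 C A B \<sigma> (spair C A B \<sigma> t u) = u"
  using assms proj1_sgpair[OF snd_ty_slift[OF assms(1)] assms(2), of u]
    proj2_sgpair[OF snd_ty_slift[OF assms(1)] assms(2), of u]
  by (simp_all add: spair_def sproj1_def sproj2_def snd_ty_sinst)

context
  fixes \<Xi> \<sigma> t
  assumes \<sigma>: "sub C \<Xi> \<Gamma> \<sigma>" and t: "tm C \<Xi> ((SigTy C A B)\<langle>\<sigma>\<rangle>) t"
begin

lemma sproj_tm:
  shows "tm C \<Xi> (A\<langle>\<sigma>\<rangle>) (sproj1 C A B \<sigma> t)"
    and "tm C \<Xi> (B\<langle>scons C A \<sigma> (sproj1 C A B \<sigma> t)\<rangle>) (sproj2 C A B \<sigma> t)"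
proof -
  note t' = t[unfolded SigTy_sub[OF A B \<sigma>]]
  show p: "tm C \<Xi> (A\<langle>\<sigma>\<rangle>) (sproj1 C A B \<sigma> t)"
    unfolding sproj1_def by (rule proj1_tm[OF tysub_ty[OF A \<sigma>] snd_ty_slift[OF \<sigma>] t'])
  show "tm C \<Xi> (B\<langle>scons C A \<sigma> (sproj1 C A B \<sigma> t)\<rangle>) (sproj2 C A B \<sigma> t)"
    using proj2_tm[OF tysub_ty[OF A \<sigma>] snd_ty_slift[OF \<sigma>] t'] snd_ty_sinst[OF \<sigma> p]
    by (simp add: sproj1_def sproj2_def)
qed

lemma spair_sproj: "spair C A B \<sigma> (sproj1 C A B \<sigma> t) (sproj2 C A B \<sigma> t) = t"
  unfolding spair_def sproj1_def sproj2_def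
  by (rule sgpair_proj[OF tysub_ty[OF A \<sigma>] snd_ty_slift[OF \<sigma>] t[unfolded SigTy_sub[OF A B \<sigma>]]])

text \<open>Stability of the projections follows from stability of pairing: expand t by eta, reindex
  the pair, and project by beta.\<close>

lemma sproj_sub:
  assumes \<delta>: "sub C \<Xi>' \<Xi> \<delta>"
  shows "(sproj1 C A B \<sigma> t)\<lbrace>\<delta>\<rbrace> = sproj1 C A B (\<sigma> \<odot> \<delta>) (t\<lbrace>\<delta>\<rbrace>)"
    and "(sproj2 C A B \<sigma> t)\<lbrace>\<delta>\<rbrace> = sproj2 C A B (\<sigma> \<odot> \<delta>) (t\<lbrace>\<delta>\<rbrace>)"
proof -
  note p = sproj_tm
  have "t\<lbrace>\<delta>\<rbrace> = spair C A B (\<sigma> \<odot> \<delta>) ((sproj1 C A B \<sigma> t)\<lbrace>\<delta>\<rbrace>) ((sproj2 C A B \<sigma> t)\<lbrace>\<delta>\<rbrace>)"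
    using spair_sub[OF \<sigma> p \<delta>] by (simp add: spair_sproj)
  then show "(sproj1 C A B \<sigma> t)\<lbrace>\<delta>\<rbrace> = sproj1 C A B (\<sigma> \<odot> \<delta>) (t\<lbrace>\<delta>\<rbrace>)"
    and "(sproj2 C A B \<sigma> t)\<lbrace>\<delta>\<rbrace> = sproj2 C A B (\<sigma> \<odot> \<delta>) (t\<lbrace>\<delta>\<rbrace>)"
    using sproj_spair[OF scomp_sub[OF \<sigma> \<delta>] tmsub_scomp_tm[OF p(1) A \<sigma> \<delta>] scons_scomp_tm[OF \<sigma> p \<delta>]]
    by simp_all
qed

lemma unpair_sub: "sub C \<Xi> (\<Gamma> \<triangleright> A \<triangleright> B) (unpair C A B \<sigma> t)"
  unfolding unpair_def by (rule scons_sub[OF scons_sub[OF \<sigma> A sproj_tm(1)] B sproj_tm(2)])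

lemma unpair_scomp:
  assumes \<delta>: "sub C \<Xi>' \<Xi> \<delta>"
  shows "unpair C A B \<sigma> t \<odot> \<delta> = unpair C A B (\<sigma> \<odot> \<delta>) (t\<lbrace>\<delta>\<rbrace>)"
  using scons_scomp[OF scons_sub[OF \<sigma> A sproj_tm(1)] B sproj_tm(2) \<delta>]
    scons_scomp[OF \<sigma> A sproj_tm(1) \<delta>]
  by (simp add: unpair_def sproj_sub[OF \<delta>])

end

lemma pp_pp_sub: "sub C (\<Gamma> \<triangleright> A \<triangleright> B) \<Gamma> (pp C A \<odot> pp C B)"
  by (rule scomp_sub[OF pp_sub[OF A] pp_sub[OF B]])

lemma var_pair_comps:
  shows "tm C (\<Gamma> \<triangleright> A \<triangleright> B) (A\<langle>pp C A \<odot> pp C B\<rangle>) ((qq C A)\<lbrace>pp C B\<rbrace>)"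
    and "tm C (\<Gamma> \<triangleright> A \<triangleright> B) (B\<langle>scons C A (pp C A \<odot> pp C B) ((qq C A)\<lbrace>pp C B\<rbrace>)\<rangle>) (qq C B)"
  using tmsub_scomp_tm[OF qq_tm[OF A] A pp_sub[OF A] pp_sub[OF B]] qq_tm[OF B]
  by (simp_all add: scons_eta[OF A pp_sub[OF B]])

lemma var_pair_tm: "tm C (\<Gamma> \<triangleright> A \<triangleright> B) ((SigTy C A B)\<langle>pp C A \<odot> pp C B\<rangle>) (var_pair C A B)"
  unfolding var_pair_def by (rule spair_tm[OF pp_pp_sub var_pair_comps])

context
  fixes \<Xi> \<sigma> t
  assumes \<sigma>: "sub C \<Xi> \<Gamma> \<sigma>" and t: "tm C \<Xi> ((SigTy C A B)\<langle>\<sigma>\<rangle>) t"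
begin

lemma pp_unpair: "pp C B \<odot> unpair C A B \<sigma> t = scons C A \<sigma> (sproj1 C A B \<sigma> t)"
  and qq_unpair: "(qq C B)\<lbrace>unpair C A B \<sigma> t\<rbrace> = sproj2 C A B \<sigma> t"
  using scons_sub[OF \<sigma> A sproj_tm(1)[OF \<sigma> t]] sproj_tm(2)[OF \<sigma> t]
  by (simp_all add: unpair_def pp_scons[OF _ B] qq_scons[OF _ B])

lemma pp_pp_unpair: "(pp C A \<odot> pp C B) \<odot> unpair C A B \<sigma> t = \<sigma>"
  using scomp_assoc[OF pp_sub[OF A] pp_sub[OF B] unpair_sub[OF \<sigma> t]]
  by (simp add: pp_unpair pp_scons[OF \<sigma> A sproj_tm(1)[OF \<sigma> t]])

text \<open>Reindexing replaces the two variables by the two projections of t, and eta reassembles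
  them.\<close>

lemma var_pair_unpair: "(var_pair C A B)\<lbrace>unpair C A B \<sigma> t\<rbrace> = t"
proof -
  note U = unpair_sub[OF \<sigma> t]
  have "(qq C A)\<lbrace>pp C B\<rbrace>\<lbrace>unpair C A B \<sigma> t\<rbrace> = sproj1 C A B \<sigma> t"
    using tmsub_scomp[OF qq_tm[OF A] pp_sub[OF B] U]
    by (simp add: pp_unpair qq_scons[OF \<sigma> A sproj_tm(1)[OF \<sigma> t]])
  then show ?thesis
    using spair_sub[OF pp_pp_sub var_pair_comps U]
    by (simp add: var_pair_def pp_pp_unpair qq_unpair spair_sproj[OF \<sigma> t])
qed

end

end

end

subsection \<open>Weak morphisms of flCwFs\<close>

text \<open>\<open>k\<close> and \<open>e \<Gamma> A\<close> invert the comparison maps of the empty context and of context extension.\<close>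

locale weak_flCwF_morphism = C: flCwF C + E: flCwF E
  for C :: "('c,'s,'t,'m) flcwf" and E :: "('d,'r,'u,'n) flcwf" (structure) +
  fixes Fc :: "'c \<Rightarrow> 'd" and Fs :: "'s \<Rightarrow> 'r" and Ft :: "'t \<Rightarrow> 'u" and Fm :: "'m \<Rightarrow> 'n"
    and k :: "'r" and e :: "'c \<Rightarrow> 't \<Rightarrow> 'r"
  assumes Fc_con: "\<Gamma> \<in> Con C \<Longrightarrow> Fc \<Gamma> \<in> Con E"
    and Fs_sub: "sub C \<Gamma> \<Delta> \<sigma> \<Longrightarrow> sub E (Fc \<Gamma>) (Fc \<Delta>) (Fs \<sigma>)"
    and Ft_ty: "ty C \<Gamma> A \<Longrightarrow> ty E (Fc \<Gamma>) (Ft A)"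
    and Fm_tm: "tm C \<Gamma> A t \<Longrightarrow> tm E (Fc \<Gamma>) (Ft A) (Fm t)"
    and Fs_idn: "\<Gamma> \<in> Con C \<Longrightarrow> Fs (idn C \<Gamma>) = idn E (Fc \<Gamma>)"
    and Fs_scomp: "sub C \<Delta> \<Theta> \<sigma> \<Longrightarrow> sub C \<Gamma> \<Delta> \<delta> \<Longrightarrow> Fs (\<sigma> \<odot>\<^bsub>C\<^esub> \<delta>) = Fs \<sigma> \<odot> Fs \<delta>"
    and Ft_sub: "ty C \<Delta> A \<Longrightarrow> sub C \<Gamma> \<Delta> \<sigma> \<Longrightarrow> Ft (A\<langle>\<sigma>\<rangle>\<^bsub>C\<^esub>) = (Ft A)\<langle>Fs \<sigma>\<rangle>"
    and Fm_sub: "tm C \<Delta> A t \<Longrightarrow> sub C \<Gamma> \<Delta> \<sigma> \<Longrightarrow> Fm (t\<lbrace>\<sigma>\<rbrace>\<^bsub>C\<^esub>) = (Fm t)\<lbrace>Fs \<sigma>\<rbrace>"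
    and k_sub: "sub E (emp E) (Fc (emp C)) k"
    and k_eps: "k \<odot> eps E (Fc (emp C)) = idn E (Fc (emp C))"
    and e_sub: "ty C \<Gamma> A \<Longrightarrow> sub E (Fc \<Gamma> \<triangleright> Ft A) (Fc (\<Gamma> \<triangleright>\<^bsub>C\<^esub> A)) (e \<Gamma> A)"
    and e_left: "ty C \<Gamma> A \<Longrightarrow>
          e \<Gamma> A \<odot> scons E (Ft A) (Fs (pp C A)) (Fm (qq C A)) = idn E (Fc (\<Gamma> \<triangleright>\<^bsub>C\<^esub> A))"
    and e_right: "ty C \<Gamma> A \<Longrightarrow>
          scons E (Ft A) (Fs (pp C A)) (Fm (qq C A)) \<odot> e \<Gamma> A = idn E (Fc \<Gamma> \<triangleright> Ft A)"
begin

section \<open>Comparison maps for context extension and the empty context\<close>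

lemma Fm_sub_tm:
  "tm C \<Gamma> (A\<langle>\<sigma>\<rangle>\<^bsub>C\<^esub>) t \<Longrightarrow> ty C \<Delta> A \<Longrightarrow> sub C \<Gamma> \<Delta> \<sigma> \<Longrightarrow>
    tm E (Fc \<Gamma>) ((Ft A)\<langle>Fs \<sigma>\<rangle>) (Fm t)"
  using Fm_tm[of \<Gamma> "A\<langle>\<sigma>\<rangle>\<^bsub>C\<^esub>" t] by (simp add: Ft_sub)

lemma Fpp_sub: "ty C \<Gamma> A \<Longrightarrow> sub E (Fc (\<Gamma> \<triangleright>\<^bsub>C\<^esub> A)) (Fc \<Gamma>) (Fs (pp C A))"
  by (rule Fs_sub[OF C.pp_sub])

lemma Fqq_tm: "ty C \<Gamma> A \<Longrightarrow> tm E (Fc (\<Gamma> \<triangleright>\<^bsub>C\<^esub> A)) ((Ft A)\<langle>Fs (pp C A)\<rangle>) (Fm (qq C A))"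
  by (rule Fm_sub_tm[OF C.qq_tm _ C.pp_sub])

lemma Fext_sub:
  "ty C \<Gamma> A \<Longrightarrow> sub E (Fc (\<Gamma> \<triangleright>\<^bsub>C\<^esub> A)) (Fc \<Gamma> \<triangleright> Ft A) (scons E (Ft A) (Fs (pp C A)) (Fm (qq C A)))"
  by (rule E.scons_sub[OF Fpp_sub Ft_ty Fqq_tm])

text \<open>Naturality of pairing shows that the comparison map (F p, F q) takes the image of
  (\<sigma>, t) to (F \<sigma>, F t); \<open>e_left\<close> then cancels the comparison map.\<close>

lemma Fs_scons:
  assumes \<sigma>: "sub C \<Gamma> \<Delta> \<sigma>" and A: "ty C \<Delta> A" and t: "tm C \<Gamma> (A\<langle>\<sigma>\<rangle>\<^bsub>C\<^esub>) t"
  shows "Fs (scons C A \<sigma> t) = e \<Delta> A \<odot> scons E (Ft A) (Fs \<sigma>) (Fm t)"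
proof -
  note s = C.scons_sub[OF \<sigma> A t]
  note Fs_s = Fs_sub[OF s]
  have 1: "Fs (pp C A) \<odot> Fs (scons C A \<sigma> t) = Fs \<sigma>"
    using Fs_scomp[OF C.pp_sub[OF A] s] by (simp add: C.pp_scons[OF \<sigma> A t])
  have 2: "(Fm (qq C A))\<lbrace>Fs (scons C A \<sigma> t)\<rbrace> = Fm t"
    using Fm_sub[OF C.qq_tm[OF A] s] by (simp add: C.qq_scons[OF \<sigma> A t])
  have "scons E (Ft A) (Fs (pp C A)) (Fm (qq C A)) \<odot> Fs (scons C A \<sigma> t) = scons E (Ft A) (Fs \<sigma>) (Fm t)"
    using E.scons_scomp[OF Fpp_sub[OF A] Ft_ty[OF A] Fqq_tm[OF A] Fs_s] 1 2 by simp
  then show ?thesis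
    using E.scomp_assoc[OF e_sub[OF A] Fext_sub[OF A] Fs_s]
    by (simp add: E.idn_left[OF Fs_s] e_left[OF A])
qed

lemma ext_e:
  assumes A: "ty C \<Gamma> A"
  shows Fpp_e: "Fs (pp C A) \<odot> e \<Gamma> A = pp E (Ft A)"
    and Fqq_e: "(Fm (qq C A))\<lbrace>e \<Gamma> A\<rbrace> = qq E (Ft A)"
proof -
  let ?f = "scons E (Ft A) (Fs (pp C A)) (Fm (qq C A))"
  note ty = Fpp_sub[OF A] Ft_ty[OF A] Fqq_tm[OF A]
  show "Fs (pp C A) \<odot> e \<Gamma> A = pp E (Ft A)"
    using E.scomp_assoc[OF E.pp_sub[OF ty(2)] Fext_sub[OF A] e_sub[OF A]]
    by (simp add: E.pp_scons[OF ty] e_right[OF A] E.idn_right[OF E.pp_sub[OF ty(2)]])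
  show "(Fm (qq C A))\<lbrace>e \<Gamma> A\<rbrace> = qq E (Ft A)"
    using E.tmsub_scomp[OF E.qq_tm[OF ty(2)] Fext_sub[OF A] e_sub[OF A]]
    by (simp add: E.qq_scons[OF ty] e_right[OF A] E.tmsub_idn[OF E.qq_tm[OF ty(2)]])
qed

text \<open>Naturality of \<open>e\<close> in the context. Through \<open>lift_slift\<close> it is
  the source of the naturality of all three isomorphisms.\<close>

lemma e_slift:
  assumes A: "ty C \<Delta> A" and \<sigma>: "sub C \<Gamma> \<Delta> \<sigma>"
  shows "Fs (slift C A \<sigma>) \<odot> e \<Gamma> (A\<langle>\<sigma>\<rangle>\<^bsub>C\<^esub>) = e \<Delta> A \<odot> slift E (Ft A) (Fs \<sigma>)"
proof -
  let ?A' = "A\<langle>\<sigma>\<rangle>\<^bsub>C\<^esub>" and ?e = "e \<Gamma> (A\<langle>\<sigma>\<rangle>\<^bsub>C\<^esub>)"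
  note A' = C.tysub_ty[OF A \<sigma>]
  note l = C.slift_tm[OF A \<sigma>]
  note Fl = Fs_sub[OF l(1)] Fm_sub_tm[OF l(2) A l(1)]
  have 1: "Fs (\<sigma> \<odot>\<^bsub>C\<^esub> pp C ?A') \<odot> ?e = Fs \<sigma> \<odot> pp E (Ft ?A')"
    using E.scomp_assoc[OF Fs_sub[OF \<sigma>] Fpp_sub[OF A'] e_sub[OF A']]
    by (simp add: Fpp_e[OF A'] Fs_scomp[OF \<sigma> C.pp_sub[OF A']])
  have "Fs (slift C A \<sigma>) \<odot> ?e =
      e \<Delta> A \<odot> (scons E (Ft A) (Fs (\<sigma> \<odot>\<^bsub>C\<^esub> pp C ?A')) (Fm (qq C ?A')) \<odot> ?e)"
    unfolding slift_def Fs_scons[OF l(1) A l(2)]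
    by (rule E.scomp_assoc[OF e_sub[OF A] E.scons_sub[OF Fl(1) Ft_ty[OF A] Fl(2)] e_sub[OF A']])
  also have "\<dots> = e \<Delta> A \<odot> scons E (Ft A) (Fs \<sigma> \<odot> pp E (Ft ?A')) (qq E (Ft ?A'))"
    by (simp add: E.scons_scomp[OF Fl(1) Ft_ty[OF A] Fl(2) e_sub[OF A']] 1 Fqq_e[OF A'])
  finally show ?thesis
    by (simp add: slift_def Ft_sub[OF A \<sigma>])
qed

text \<open>Here \<rho> is an arbitrary substitution of E. The lemma recognizes the part coming from
  C in a substitution out of a context that is not an image.\<close>

lemma e_scons:
  assumes "sub C \<Gamma> \<Delta> \<sigma>" "ty C \<Delta> A" "tm C \<Gamma> (A\<langle>\<sigma>\<rangle>\<^bsub>C\<^esub>) t" "sub E \<Xi> (Fc \<Gamma>) \<rho>"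
  shows "e \<Delta> A \<odot> scons E (Ft A) (Fs \<sigma> \<odot> \<rho>) ((Fm t)\<lbrace>\<rho>\<rbrace>) = Fs (scons C A \<sigma> t) \<odot> \<rho>"
proof -
  note ty = Fs_sub[OF assms(1)] Ft_ty[OF assms(2)] Fm_sub_tm[OF assms(3,2,1)]
  show ?thesis
    using E.scomp_assoc[OF e_sub[OF assms(2)] E.scons_sub[OF ty] assms(4)]
    by (simp add: Fs_scons[OF assms(1-3)] E.scons_scomp[OF ty assms(4)])
qed

lemma e_sinst:
  "tm C \<Gamma> A t \<Longrightarrow> e \<Gamma> A \<odot> sinst E (Fc \<Gamma>) (Ft A) (Fm t) = Fs (sinst C \<Gamma> A t)"
  unfolding sinst_def
  by (simp add: Fs_scons[OF C.idn_sub[OF C.ty_con[OF C.tm_ty]] C.tm_ty C.sinst_tm]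
      Fs_idn[OF C.ty_con[OF C.tm_ty]])

text \<open>A retraction k of eps suffices: every map into the image of the empty context equals k
  composed with eps of its source.\<close>

lemma Fs_eps_unique:
  assumes "sub E \<Xi> (Fc (emp C)) \<sigma>" "sub E \<Xi> (Fc (emp C)) \<tau>"
  shows "\<sigma> = \<tau>"
proof -
  have "\<upsilon> = k \<odot> eps E \<Xi>" if "sub E \<Xi> (Fc (emp C)) \<upsilon>" for \<upsilon>
    using E.scomp_assoc[OF k_sub E.eps_sub[OF E.sub_con(2)[OF that]] that]
    by (simp add: k_eps E.idn_left[OF that] E.eps_scomp[OF that])
  with assms show ?thesis by metis
qed

section \<open>Type morphisms out of an image type\<close>

definition lift :: "'c \<Rightarrow> 't \<Rightarrow> 'n \<Rightarrow> 'n" where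
  "lift \<Gamma> X w = w\<lbrace>e \<Gamma> X\<rbrace>"

lemma lift_ty_mor:
  assumes X: "ty C \<Gamma> X" and Y: "ty E (Fc \<Gamma>) Y"
    and w: "tm E (Fc (\<Gamma> \<triangleright>\<^bsub>C\<^esub> X)) (Y\<langle>Fs (pp C X)\<rangle>) w"
  shows "ty_mor E (Fc \<Gamma>) (Ft X) Y (lift \<Gamma> X w)"
  using E.tmsub_scomp_tm[OF w Y Fpp_sub[OF X] e_sub[OF X]] X Y
  by (simp add: ty_mor_def lift_def Fpp_e Ft_ty)

text \<open>\<open>gw\<close> and \<open>wg\<close> are the two inverse laws with \<open>e\<close>
  moved out of the morphism. Reindexing \<open>gw\<close> along \<open>e\<close> gives the first
  law, because \<open>e\<close> takes F q to q; in \<open>wg\<close> the map \<open>e\<close> is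
  absorbed into the substitution. Both can then be checked over image contexts.\<close>

lemma lift_iso:
  assumes X: "ty C \<Gamma> X" and Y: "ty E (Fc \<Gamma>) Y"
    and w: "tm E (Fc (\<Gamma> \<triangleright>\<^bsub>C\<^esub> X)) (Y\<langle>Fs (pp C X)\<rangle>) w"
    and g: "tm E (Fc \<Gamma> \<triangleright> Y) ((Ft X)\<langle>pp E Y\<rangle>) g"
    and gw: "g\<lbrace>scons E Y (Fs (pp C X)) w\<rbrace> = Fm (qq C X)"
    and wg: "w\<lbrace>e \<Gamma> X \<odot> scons E (Ft X) (pp E Y) g\<rbrace> = qq E Y"
  shows "ty_iso E (Fc \<Gamma>) (Ft X) Y (lift \<Gamma> X w)"
proof -
  note FX = Ft_ty[OF X]
  have s: "sub E (Fc (\<Gamma> \<triangleright>\<^bsub>C\<^esub> X)) (Fc \<Gamma> \<triangleright> Y) (scons E Y (Fs (pp C X)) w)"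
    by (rule E.scons_sub[OF Fpp_sub[OF X] Y w])
  have "scons E Y (pp E (Ft X)) (lift \<Gamma> X w) = scons E Y (Fs (pp C X)) w \<odot> e \<Gamma> X"
    by (simp add: E.scons_scomp[OF Fpp_sub[OF X] Y w e_sub[OF X]] lift_def Fpp_e[OF X])
  then have "tycomp E (Ft X) Y g (lift \<Gamma> X w) = qq E (Ft X)"
    by (simp add: tycomp_def E.tmsub_scomp[OF g s e_sub[OF X]] gw Fqq_e[OF X])
  moreover have "tycomp E Y (Ft X) (lift \<Gamma> X w) g = qq E Y"
    using E.tmsub_scomp[OF w e_sub[OF X] E.scons_sub[OF E.pp_sub[OF Y] FX g]]
    by (simp add: tycomp_def lift_def wg)
  moreover have "ty_mor E (Fc \<Gamma>) Y (Ft X) g"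
    by (simp add: ty_mor_def FX Y g)
  ultimately show ?thesis
    using lift_ty_mor[OF X Y w] by (auto simp: ty_iso_def)
qed

text \<open>The map \<open>e\<close> composed with (id, F t) is the image of (id, t). The action on
  F t is therefore w reindexed along an image substitution, where its stability applies.\<close>

lemma tyact_lift:
  assumes t: "tm C \<Gamma> X t" and w: "tm E (Fc (\<Gamma> \<triangleright>\<^bsub>C\<^esub> X)) W w"
  shows "tyact E (Fc \<Gamma>) (Ft X) (lift \<Gamma> X w) (Fm t) = w\<lbrace>Fs (sinst C \<Gamma> X t)\<rbrace>"
  using E.tmsub_scomp[OF w e_sub[OF C.tm_ty[OF t]] E.sinst_sub[OF Fm_tm[OF t]]]
  by (simp add: tyact_def lift_def e_sinst[OF t])

text \<open>Reduces naturality of a lifted morphism to the behaviour of w under the image of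
  \<open>slift\<close>.\<close>

lemma lift_slift:
  assumes X: "ty C \<Delta> X" and w: "tm E (Fc (\<Delta> \<triangleright>\<^bsub>C\<^esub> X)) W w" and \<sigma>: "sub C \<Gamma> \<Delta> \<sigma>"
  shows "(lift \<Delta> X w)\<lbrace>slift E (Ft X) (Fs \<sigma>)\<rbrace> = lift \<Gamma> (X\<langle>\<sigma>\<rangle>\<^bsub>C\<^esub>) (w\<lbrace>Fs (slift C X \<sigma>)\<rbrace>)"
  using E.tmsub_scomp[OF w e_sub[OF X] E.slift_sub[OF Ft_ty[OF X] Fs_sub[OF \<sigma>]]]
    E.tmsub_scomp[OF w Fs_sub[OF C.slift_sub[OF X \<sigma>]] e_sub[OF C.tysub_ty[OF X \<sigma>]]]
  by (simp add: lift_def e_slift[OF X \<sigma>])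

subsection \<open>Preservation of dependent sums\<close>

definition Fpair :: "'c \<Rightarrow> 't \<Rightarrow> 't \<Rightarrow> 's \<Rightarrow> 'm \<Rightarrow> 'n" where
  "Fpair \<Gamma> A B \<sigma> t =
    spair E (Ft A) ((Ft B)\<langle>e \<Gamma> A\<rangle>) (Fs \<sigma>) (Fm (sproj1 C A B \<sigma> t)) (Fm (sproj2 C A B \<sigma> t))"

definition FSig :: "'c \<Rightarrow> 't \<Rightarrow> 't \<Rightarrow> 'n" where
  "FSig \<Gamma> A B =
    lift \<Gamma> (SigTy C A B) (Fpair \<Gamma> A B (pp C (SigTy C A B)) (qq C (SigTy C A B)))"

text \<open>The analogue of \<open>e\<close> for a double extension. The inner \<open>slift\<close>
  is needed because F B lives over the image of \<Gamma> \<triangleright> A and first has to be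
  pulled back along \<open>e\<close>.\<close>

definition e2 :: "'c \<Rightarrow> 't \<Rightarrow> 't \<Rightarrow> 'r" where
  "e2 \<Gamma> A B = e (\<Gamma> \<triangleright>\<^bsub>C\<^esub> A) B \<odot> slift E (Ft B) (e \<Gamma> A)"

context
  fixes \<Gamma> A B
  assumes A: "ty C \<Gamma> A" and B: "ty C (\<Gamma> \<triangleright>\<^bsub>C\<^esub> A) B"
begin

lemma FB_ty: "ty E (Fc \<Gamma> \<triangleright> Ft A) ((Ft B)\<langle>e \<Gamma> A\<rangle>)"
  by (rule E.tysub_ty[OF Ft_ty[OF B] e_sub[OF A]])

lemma Fm_snd_tm:
  assumes \<sigma>: "sub C \<Xi> \<Gamma> \<sigma>" and t: "tm C \<Xi> (A\<langle>\<sigma>\<rangle>\<^bsub>C\<^esub>) t" and u: "tm C \<Xi> (B\<langle>scons C A \<sigma> t\<rangle>\<^bsub>C\<^esub>) u"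
  shows "tm E (Fc \<Xi>) ((Ft B)\<langle>e \<Gamma> A\<rangle>\<langle>scons E (Ft A) (Fs \<sigma>) (Fm t)\<rangle>) (Fm u)"
  using Fm_sub_tm[OF u B C.scons_sub[OF \<sigma> A t]]
    E.tysub_scomp[OF Ft_ty[OF B] e_sub[OF A] E.scons_sub[OF Fs_sub[OF \<sigma>] Ft_ty[OF A] Fm_sub_tm[OF t A \<sigma>]]]
  by (simp add: Fs_scons[OF \<sigma> A t])

lemma Fpair_tm:
  assumes \<sigma>: "sub C \<Xi> \<Gamma> \<sigma>" and t: "tm C \<Xi> ((SigTy C A B)\<langle>\<sigma>\<rangle>\<^bsub>C\<^esub>) t"
  shows "tm E (Fc \<Xi>) ((SigTy E (Ft A) ((Ft B)\<langle>e \<Gamma> A\<rangle>))\<langle>Fs \<sigma>\<rangle>) (Fpair \<Gamma> A B \<sigma> t)"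
  unfolding Fpair_def
  by (rule E.spair_tm[OF Ft_ty[OF A] FB_ty Fs_sub[OF \<sigma>]
      Fm_sub_tm[OF C.sproj_tm(1)[OF A B \<sigma> t] A \<sigma>] Fm_snd_tm[OF \<sigma> C.sproj_tm[OF A B \<sigma> t]]])

lemma Fpair_sub:
  assumes \<sigma>: "sub C \<Xi> \<Gamma> \<sigma>" and t: "tm C \<Xi> ((SigTy C A B)\<langle>\<sigma>\<rangle>\<^bsub>C\<^esub>) t" and \<delta>: "sub C \<Xi>' \<Xi> \<delta>"
  shows "(Fpair \<Gamma> A B \<sigma> t)\<lbrace>Fs \<delta>\<rbrace> = Fpair \<Gamma> A B (\<sigma> \<odot>\<^bsub>C\<^esub> \<delta>) (t\<lbrace>\<delta>\<rbrace>\<^bsub>C\<^esub>)"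
proof -
  note p = C.sproj_tm[OF A B \<sigma> t]
  show ?thesis
    using E.spair_sub[OF Ft_ty[OF A] FB_ty Fs_sub[OF \<sigma>] Fm_sub_tm[OF p(1) A \<sigma>]
        Fm_snd_tm[OF \<sigma> p] Fs_sub[OF \<delta>]]
    by (simp add: Fpair_def Fs_scomp[OF \<sigma> \<delta>] Fm_sub[OF p(1) \<delta>, symmetric]
        Fm_sub[OF p(2) \<delta>, symmetric] C.sproj_sub[OF A B \<sigma> t \<delta>])
qed

text \<open>A substitution can be moved from the relative argument into the types, since both sides
  then pair and project at the same types. For the second component type of the target this rests on
  \<open>e_slift\<close>.\<close>

lemma Fpair_tysub:
  assumes \<sigma>: "sub C \<Delta> \<Gamma> \<sigma>" and \<delta>: "sub C \<Xi> \<Delta> \<delta>"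
  shows "Fpair \<Gamma> A B (\<sigma> \<odot>\<^bsub>C\<^esub> \<delta>) t = Fpair \<Delta> (A\<langle>\<sigma>\<rangle>\<^bsub>C\<^esub>) (B\<langle>slift C A \<sigma>\<rangle>\<^bsub>C\<^esub>) \<delta> t"
proof -
  note A' = C.tysub_ty[OF A \<sigma>] and l = C.slift_sub[OF A \<sigma>]
  have "(Ft (B\<langle>slift C A \<sigma>\<rangle>\<^bsub>C\<^esub>))\<langle>e \<Delta> (A\<langle>\<sigma>\<rangle>\<^bsub>C\<^esub>)\<rangle> = (Ft B)\<langle>e \<Gamma> A\<rangle>\<langle>slift E (Ft A) (Fs \<sigma>)\<rangle>"
    using E.tysub_scomp[OF Ft_ty[OF B] Fs_sub[OF l] e_sub[OF A']]
      E.tysub_scomp[OF Ft_ty[OF B] e_sub[OF A] E.slift_sub[OF Ft_ty[OF A] Fs_sub[OF \<sigma>]]]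
    by (simp add: Ft_sub[OF B l] e_slift[OF A \<sigma>])
  then have "(Ft (B\<langle>slift C A \<sigma>\<rangle>\<^bsub>C\<^esub>))\<langle>e \<Delta> (A\<langle>\<sigma>\<rangle>\<^bsub>C\<^esub>)\<rangle>\<langle>slift E (Ft (A\<langle>\<sigma>\<rangle>\<^bsub>C\<^esub>)) (Fs \<delta>)\<rangle> =
      (Ft B)\<langle>e \<Gamma> A\<rangle>\<langle>slift E (Ft A) (Fs \<sigma> \<odot> Fs \<delta>)\<rangle>"
    using E.snd_ty_slift_slift[OF Ft_ty[OF A] FB_ty Fs_sub[OF \<sigma>] Fs_sub[OF \<delta>]]
    by (simp add: Ft_sub[OF A \<sigma>])
  moreover have "(Ft (A\<langle>\<sigma>\<rangle>\<^bsub>C\<^esub>))\<langle>Fs \<delta>\<rangle> = (Ft A)\<langle>Fs \<sigma> \<odot> Fs \<delta>\<rangle>"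
    by (simp add: Ft_sub[OF A \<sigma>] E.tysub_scomp[OF Ft_ty[OF A] Fs_sub[OF \<sigma>] Fs_sub[OF \<delta>]])
  ultimately show ?thesis
    by (simp add: Fpair_def spair_def sproj1_def sproj2_def Fs_scomp[OF \<sigma> \<delta>] C.tysub_scomp[OF A \<sigma> \<delta>]
        C.snd_ty_slift_slift[OF A B \<sigma> \<delta>])
qed

lemma Fpair_idn:
  "Fpair \<Gamma> A B (idn C \<Gamma>) t =
    sgpair E (Ft A) ((Ft B)\<langle>e \<Gamma> A\<rangle>) (Fm (proj1 C A B t)) (Fm (proj2 C A B t))"
  using C.ty_con[OF A]
  by (simp add: Fpair_def spair_def sproj1_def sproj2_def Fs_idn C.tysub_idn[OF A] C.slift_idn[OF A]
      C.tysub_idn[OF B] E.tysub_idn[OF Ft_ty[OF A]] E.slift_idn[OF Ft_ty[OF A]] E.tysub_idn[OF FB_ty])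

lemma e2_sub: "sub E (Fc \<Gamma> \<triangleright> Ft A \<triangleright> (Ft B)\<langle>e \<Gamma> A\<rangle>) (Fc (\<Gamma> \<triangleright>\<^bsub>C\<^esub> A \<triangleright>\<^bsub>C\<^esub> B)) (e2 \<Gamma> A B)"
  unfolding e2_def by (rule E.scomp_sub[OF e_sub[OF B] E.slift_sub[OF Ft_ty[OF B] e_sub[OF A]]])

text \<open>F commutes with taking pairs apart, up to \<open>e2\<close>: beta recovers the images of
  the projections, and two uses of \<open>Fs_scons\<close> collect them into one image substitution.
  This gives one inverse law of \<open>FSig_iso\<close>.\<close>

lemma e2_unpair:
  assumes \<sigma>: "sub C \<Xi> \<Gamma> \<sigma>" and t: "tm C \<Xi> ((SigTy C A B)\<langle>\<sigma>\<rangle>\<^bsub>C\<^esub>) t"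
  shows "e2 \<Gamma> A B \<odot> unpair E (Ft A) ((Ft B)\<langle>e \<Gamma> A\<rangle>) (Fs \<sigma>) (Fpair \<Gamma> A B \<sigma> t) = Fs (unpair C A B \<sigma> t)"
proof -
  let ?p = "sproj1 C A B \<sigma> t" and ?r = "sproj2 C A B \<sigma> t"
  note p = C.sproj_tm[OF A B \<sigma> t]
  note s = C.scons_sub[OF \<sigma> A p(1)]
  note Fp = Fm_sub_tm[OF p(1) A \<sigma>] and Fr = Fm_snd_tm[OF \<sigma> p]
  let ?f = "scons E (Ft A) (Fs \<sigma>) (Fm ?p)"
  have f: "sub E (Fc \<Xi>) (Fc \<Gamma> \<triangleright> Ft A) ?f"
    by (rule E.scons_sub[OF Fs_sub[OF \<sigma>] Ft_ty[OF A] Fp])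
  have "unpair E (Ft A) ((Ft B)\<langle>e \<Gamma> A\<rangle>) (Fs \<sigma>) (Fpair \<Gamma> A B \<sigma> t) =
      scons E ((Ft B)\<langle>e \<Gamma> A\<rangle>) ?f (Fm ?r)"
    by (simp add: unpair_def Fpair_def E.sproj_spair[OF Ft_ty[OF A] FB_ty Fs_sub[OF \<sigma>] Fp Fr])
  then show ?thesis
    using E.scomp_assoc[OF e_sub[OF B] E.slift_sub[OF Ft_ty[OF B] e_sub[OF A]]
        E.scons_sub[OF f FB_ty Fr]]
    by (simp add: e2_def E.slift_scons[OF Ft_ty[OF B] e_sub[OF A] f Fr] unpair_def Fs_scons[OF s B p(2)]
        Fs_scons[OF \<sigma> A p(1)])
qed

lemma Fpp_e2: "Fs (pp C B) \<odot> e2 \<Gamma> A B = e \<Gamma> A \<odot> pp E ((Ft B)\<langle>e \<Gamma> A\<rangle>)"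
  and Fqq_e2: "(Fm (qq C B))\<lbrace>e2 \<Gamma> A B\<rbrace> = qq E ((Ft B)\<langle>e \<Gamma> A\<rangle>)"
proof -
  note FB = Ft_ty[OF B]
  note l = E.slift_sub[OF FB e_sub[OF A]]
  show "Fs (pp C B) \<odot> e2 \<Gamma> A B = e \<Gamma> A \<odot> pp E ((Ft B)\<langle>e \<Gamma> A\<rangle>)"
    using E.scomp_assoc[OF Fpp_sub[OF B] e_sub[OF B] l]
    by (simp add: e2_def Fpp_e[OF B] E.pp_slift[OF FB e_sub[OF A]])
  show "(Fm (qq C B))\<lbrace>e2 \<Gamma> A B\<rbrace> = qq E ((Ft B)\<langle>e \<Gamma> A\<rangle>)"
    using E.tmsub_scomp[OF Fqq_tm[OF B] e_sub[OF B] l]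
    by (simp add: e2_def Fqq_e[OF B] E.qq_slift[OF FB e_sub[OF A]])
qed

lemma Fpp_pp_e2: "Fs (pp C A \<odot>\<^bsub>C\<^esub> pp C B) \<odot> e2 \<Gamma> A B = pp E (Ft A) \<odot> pp E ((Ft B)\<langle>e \<Gamma> A\<rangle>)"
  using E.scomp_assoc[OF Fpp_sub[OF A] Fpp_sub[OF B] e2_sub]
    E.scomp_assoc[OF Fpp_sub[OF A] e_sub[OF A] E.pp_sub[OF FB_ty]]
  by (simp add: Fs_scomp[OF C.pp_sub[OF A] C.pp_sub[OF B]] Fpp_e2 Fpp_e[OF A])

text \<open>The projections of the generic pair are the variables, and \<open>e2\<close> takes
  images of variables to variables. This gives the other inverse law of
  \<open>FSig_iso\<close>.\<close>

lemma Fpair_var_pair: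
  "(Fpair \<Gamma> A B (pp C A \<odot>\<^bsub>C\<^esub> pp C B) (var_pair C A B))\<lbrace>e2 \<Gamma> A B\<rbrace> = var_pair E (Ft A) ((Ft B)\<langle>e \<Gamma> A\<rangle>)"
proof -
  note v = C.pp_pp_sub[OF A B] C.var_pair_comps[OF A B]
  have "(Fm ((qq C A)\<lbrace>pp C B\<rbrace>\<^bsub>C\<^esub>))\<lbrace>e2 \<Gamma> A B\<rbrace> = (qq E (Ft A))\<lbrace>pp E ((Ft B)\<langle>e \<Gamma> A\<rangle>)\<rbrace>"
    using E.tmsub_scomp[OF Fqq_tm[OF A] Fpp_sub[OF B] e2_sub]
      E.tmsub_scomp[OF Fqq_tm[OF A] e_sub[OF A] E.pp_sub[OF FB_ty]]
    by (simp add: Fm_sub[OF C.qq_tm[OF A] C.pp_sub[OF B]] Fpp_e2 Fqq_e[OF A])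
  then show ?thesis
    using E.spair_sub[OF Ft_ty[OF A] FB_ty Fs_sub[OF v(1)] Fm_sub_tm[OF v(2) A v(1)] Fm_snd_tm[OF v]
        e2_sub]
    by (simp add: Fpair_def var_pair_def C.sproj_spair[OF A B v] Fpp_pp_e2 Fqq_e2)
qed

lemma FSig_iso:
  "ty_iso E (Fc \<Gamma>) (Ft (SigTy C A B)) (SigTy E (Ft A) ((Ft B)\<langle>e \<Gamma> A\<rangle>)) (FSig \<Gamma> A B)"
proof -
  let ?X = "SigTy C A B" and ?Y = "SigTy E (Ft A) ((Ft B)\<langle>e \<Gamma> A\<rangle>)"
  let ?w = "Fpair \<Gamma> A B (pp C ?X) (qq C ?X)" and ?v = "var_pair C A B"
    and ?pp = "pp C A \<odot>\<^bsub>C\<^esub> pp C B"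
  let ?U = "unpair E (Ft A) ((Ft B)\<langle>e \<Gamma> A\<rangle>) (pp E ?Y) (qq E ?Y)"
  note FA = Ft_ty[OF A]
  note X = C.SigTy_ty[OF A B] and Y = E.SigTy_ty[OF FA FB_ty]
  note FX = Ft_ty[OF X]
  note w = Fpair_tm[OF C.pp_sub[OF X] C.qq_tm[OF X]]
  note v = C.var_pair_tm[OF A B] and pp = C.pp_pp_sub[OF A B]
  note U = E.unpair_sub[OF FA FB_ty E.pp_sub[OF Y] E.qq_tm[OF Y]]
  note e2U = E.scomp_sub[OF e2_sub U]
  note P = C.scons_sub[OF pp X v]
  \<comment> \<open>This equation gives the candidate inverse the type F X reindexed along
    p.\<close>
  have ppU: "Fs ?pp \<odot> (e2 \<Gamma> A B \<odot> ?U) = pp E ?Y"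
    using E.scomp_assoc[OF Fs_sub[OF pp] e2_sub U]
    by (simp add: Fpp_pp_e2 E.pp_pp_unpair[OF FA FB_ty E.pp_sub[OF Y] E.qq_tm[OF Y]])
  show ?thesis
    unfolding FSig_def
  proof (rule lift_iso[OF X Y w])
    show "tm E (Fc \<Gamma> \<triangleright> ?Y) ((Ft ?X)\<langle>pp E ?Y\<rangle>) ((Fm ?v)\<lbrace>e2 \<Gamma> A B \<odot> ?U\<rbrace>)"
      using E.tmsub_scomp_tm[OF Fm_sub_tm[OF v X pp] FX Fs_sub[OF pp] e2U] by (simp add: ppU)
    have w0: "sub E (Fc (\<Gamma> \<triangleright>\<^bsub>C\<^esub> ?X)) (Fc \<Gamma> \<triangleright> ?Y) (scons E ?Y (Fs (pp C ?X)) ?w)"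
      by (rule E.scons_sub[OF Fpp_sub[OF X] Y w])
    have "?U \<odot> scons E ?Y (Fs (pp C ?X)) ?w = unpair E (Ft A) ((Ft B)\<langle>e \<Gamma> A\<rangle>) (Fs (pp C ?X)) ?w"
      by (simp add: E.unpair_scomp[OF FA FB_ty E.pp_sub[OF Y] E.qq_tm[OF Y] w0]
          E.pp_scons[OF Fpp_sub[OF X] Y w] E.qq_scons[OF Fpp_sub[OF X] Y w])
    then have "(e2 \<Gamma> A B \<odot> ?U) \<odot> scons E ?Y (Fs (pp C ?X)) ?w = Fs (unpair C A B (pp C ?X) (qq C ?X))"
      by (simp add: E.scomp_assoc[OF e2_sub U w0] e2_unpair[OF C.pp_sub[OF X] C.qq_tm[OF X]])
    then show "(Fm ?v)\<lbrace>e2 \<Gamma> A B \<odot> ?U\<rbrace>\<lbrace>scons E ?Y (Fs (pp C ?X)) ?w\<rbrace> = Fm (qq C ?X)"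
      using E.tmsub_scomp[OF Fm_tm[OF v] e2U w0]
        Fm_sub[OF v C.unpair_sub[OF A B C.pp_sub[OF X] C.qq_tm[OF X]]]
      by (simp add: C.var_pair_unpair[OF A B C.pp_sub[OF X] C.qq_tm[OF X]])
    \<comment> \<open>The right-hand side begins with an image substitution, so
      \<open>Fpair_sub\<close> applies to \<open>?w\<close> and turns it into the image of the
      generic pair taken apart and re-paired.\<close>
    have "e \<Gamma> ?X \<odot> scons E (Ft ?X) (pp E ?Y) ((Fm ?v)\<lbrace>e2 \<Gamma> A B \<odot> ?U\<rbrace>) = Fs (scons C ?X ?pp ?v) \<odot> (e2 \<Gamma> A B \<odot> ?U)"
      using e_scons[OF pp X v e2U] by (simp add: ppU)
    then show "?w\<lbrace>e \<Gamma> ?X \<odot> scons E (Ft ?X) (pp E ?Y) ((Fm ?v)\<lbrace>e2 \<Gamma> A B \<odot> ?U\<rbrace>)\<rbrace> = qq E ?Y"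
      using E.tmsub_scomp[OF w Fs_sub[OF P] e2U]
        E.tmsub_scomp[OF Fpair_tm[OF pp v] e2_sub U]
      by (simp add: Fpair_sub[OF C.pp_sub[OF X] C.qq_tm[OF X] P] C.pp_scons[OF pp X v]
          C.qq_scons[OF pp X v] Fpair_var_pair E.var_pair_unpair[OF FA FB_ty E.pp_sub[OF Y] E.qq_tm[OF Y]])
  qed
qed

lemma tyact_FSig:
  assumes t: "tm C \<Gamma> (SigTy C A B) t"
  shows "tyact E (Fc \<Gamma>) (Ft (SigTy C A B)) (FSig \<Gamma> A B) (Fm t) =
    sgpair E (Ft A) ((Ft B)\<langle>e \<Gamma> A\<rangle>) (Fm (proj1 C A B t)) (Fm (proj2 C A B t))"
proof -
  note X = C.SigTy_ty[OF A B]
  show ?thesis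
    unfolding FSig_def tyact_lift[OF t Fpair_tm[OF C.pp_sub[OF X] C.qq_tm[OF X]]]
    by (simp add: Fpair_sub[OF C.pp_sub[OF X] C.qq_tm[OF X] C.sinst_sub[OF t]] C.pp_sinst[OF t]
        C.qq_sinst[OF t] Fpair_idn)
qed

lemma proj_tyact_FSig:
  assumes t: "tm C \<Gamma> (SigTy C A B) t"
  defines "t' \<equiv> tyact E (Fc \<Gamma>) (Ft (SigTy C A B)) (FSig \<Gamma> A B) (Fm t)"
  shows "proj1 E (Ft A) ((Ft B)\<langle>e \<Gamma> A\<rangle>) t' = Fm (proj1 C A B t)"
    and "proj2 E (Ft A) ((Ft B)\<langle>e \<Gamma> A\<rangle>) t' = Fm (proj2 C A B t)"
proof -
  note p = C.proj1_tm[OF A B t] and r = C.proj2_tm[OF A B t]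
  note s = C.sinst_sub[OF p]
  have "tm E (Fc \<Gamma>) ((Ft B)\<langle>e \<Gamma> A\<rangle>\<langle>sinst E (Fc \<Gamma>) (Ft A) (Fm (proj1 C A B t))\<rangle>) (Fm (proj2 C A B t))"
    using Fm_sub_tm[OF r B s] E.tysub_scomp[OF Ft_ty[OF B] e_sub[OF A] E.sinst_sub[OF Fm_tm[OF p]]]
    by (simp add: e_sinst[OF p])
  note pr = FB_ty Fm_tm[OF p] this
  show "proj1 E (Ft A) ((Ft B)\<langle>e \<Gamma> A\<rangle>) t' = Fm (proj1 C A B t)"
    and "proj2 E (Ft A) ((Ft B)\<langle>e \<Gamma> A\<rangle>) t' = Fm (proj2 C A B t)"
    by (simp_all add: t'_def tyact_FSig[OF t] E.proj1_sgpair[OF pr] E.proj2_sgpair[OF pr])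
qed

end

text \<open>Stability of the pair leaves it relative to \<sigma> composed with p;
  \<open>Fpair_tysub\<close> moves \<sigma> into the types, which produces the isomorphism for the
  substituted data.\<close>

lemma FSig_slift:
  assumes \<sigma>: "sub C \<Gamma> \<Delta> \<sigma>" and A: "ty C \<Delta> A" and B: "ty C (\<Delta> \<triangleright>\<^bsub>C\<^esub> A) B"
  shows "(FSig \<Delta> A B)\<lbrace>slift E (Ft (SigTy C A B)) (Fs \<sigma>)\<rbrace> =
    FSig \<Gamma> (A\<langle>\<sigma>\<rangle>\<^bsub>C\<^esub>) (B\<langle>slift C A \<sigma>\<rangle>\<^bsub>C\<^esub>)"
proof -
  note X = C.SigTy_ty[OF A B]
  note X\<sigma> = C.tysub_ty[OF X \<sigma>]
  show ?thesis
    unfolding FSig_def lift_slift[OF X Fpair_tm[OF A B C.pp_sub[OF X] C.qq_tm[OF X]] \<sigma>]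
    by (simp add: Fpair_sub[OF A B C.pp_sub[OF X] C.qq_tm[OF X] C.slift_sub[OF X \<sigma>]]
        C.pp_slift[OF X \<sigma>] C.qq_slift[OF X \<sigma>] Fpair_tysub[OF A B \<sigma> C.pp_sub[OF X\<sigma>]]
        flip: C.SigTy_sub[OF A B \<sigma>])
qed

subsection \<open>Preservation of constant families\<close>

definition FK :: "'c \<Rightarrow> 'c \<Rightarrow> 'n" where
  "FK \<Gamma> \<Delta> = lift \<Gamma> (KTy C \<Gamma> \<Delta>) (lamK E (Fs (appK C \<Delta> (qq C (KTy C \<Gamma> \<Delta>)))))"

lemma K_qq_tm:
  "\<Gamma> \<in> Con C \<Longrightarrow> \<Delta> \<in> Con C \<Longrightarrow>
    tm C (\<Gamma> \<triangleright>\<^bsub>C\<^esub> KTy C \<Gamma> \<Delta>) (KTy C (\<Gamma> \<triangleright>\<^bsub>C\<^esub> KTy C \<Gamma> \<Delta>) \<Delta>) (qq C (KTy C \<Gamma> \<Delta>))"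
  using C.qq_tm[OF C.KTy_ty[of \<Gamma> \<Delta>]] C.KTy_sub[OF _ C.pp_sub[OF C.KTy_ty], of \<Delta> \<Gamma> \<Delta>] by simp

lemma appK_qq_sub:
  "\<Gamma> \<in> Con C \<Longrightarrow> \<Delta> \<in> Con C \<Longrightarrow>
    sub C (\<Gamma> \<triangleright>\<^bsub>C\<^esub> KTy C \<Gamma> \<Delta>) \<Delta> (appK C \<Delta> (qq C (KTy C \<Gamma> \<Delta>)))"
  by (rule C.appK_sub[OF _ K_qq_tm])

lemma FlamK_tm:
  assumes \<Gamma>: "\<Gamma> \<in> Con C" and \<Delta>: "\<Delta> \<in> Con C"
  shows "tm E (Fc (\<Gamma> \<triangleright>\<^bsub>C\<^esub> KTy C \<Gamma> \<Delta>)) ((KTy E (Fc \<Gamma>) (Fc \<Delta>))\<langle>Fs (pp C (KTy C \<Gamma> \<Delta>))\<rangle>)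
    (lamK E (Fs (appK C \<Delta> (qq C (KTy C \<Gamma> \<Delta>)))))"
  using E.lamK_tm[OF Fs_sub[OF appK_qq_sub[OF \<Gamma> \<Delta>]]]
  by (simp add: E.KTy_sub[OF Fc_con[OF \<Delta>] Fpp_sub[OF C.KTy_ty[OF \<Gamma> \<Delta>]]])

lemma KTy_eps: "\<Gamma> \<in> Con C \<Longrightarrow> \<Delta> \<in> Con C \<Longrightarrow> (KTy C (emp C) \<Delta>)\<langle>eps C \<Gamma>\<rangle>\<^bsub>C\<^esub> = KTy C \<Gamma> \<Delta>"
  by (rule C.KTy_sub[OF _ C.eps_sub])

text \<open>Constant families are pulled back from the empty context, whose image is still terminal.\<close>

lemma FK_tysub_unique:
  assumes r: "sub E \<Xi> (Fc \<Gamma>) r" and r': "sub E \<Xi> (Fc \<Gamma>') r'"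
    and "\<Gamma> \<in> Con C" "\<Gamma>' \<in> Con C" and \<Delta>: "\<Delta> \<in> Con C"
  shows "(Ft (KTy C \<Gamma> \<Delta>))\<langle>r\<rangle> = (Ft (KTy C \<Gamma>' \<Delta>))\<langle>r'\<rangle>"
proof -
  let ?K = "KTy C (emp C) \<Delta>"
  note K = C.KTy_ty[OF C.emp_con \<Delta>]
  have *: "(Ft (KTy C \<Gamma> \<Delta>))\<langle>r\<rangle> = (Ft ?K)\<langle>Fs (eps C \<Gamma>) \<odot> r\<rangle>"
    if "\<Gamma> \<in> Con C" "sub E \<Xi> (Fc \<Gamma>) r" for \<Gamma> r
    using Ft_sub[OF K C.eps_sub[OF that(1)]]
      E.tysub_scomp[OF Ft_ty[OF K] Fs_sub[OF C.eps_sub[OF that(1)]] that(2)]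
    by (simp add: KTy_eps[OF that(1) \<Delta>])
  have "Fs (eps C \<Gamma>) \<odot> r = Fs (eps C \<Gamma>') \<odot> r'"
    by (rule Fs_eps_unique[OF E.scomp_sub[OF Fs_sub[OF C.eps_sub] r] E.scomp_sub[OF Fs_sub[OF C.eps_sub] r']])
      (fact assms)+
  with assms show ?thesis by (simp add: *)
qed

lemma FK_iso:
  assumes \<Gamma>: "\<Gamma> \<in> Con C" and \<Delta>: "\<Delta> \<in> Con C"
  shows "ty_iso E (Fc \<Gamma>) (Ft (KTy C \<Gamma> \<Delta>)) (KTy E (Fc \<Gamma>) (Fc \<Delta>)) (FK \<Gamma> \<Delta>)"
proof -
  let ?X = "KTy C \<Gamma> \<Delta>" and ?Y = "KTy E (Fc \<Gamma>) (Fc \<Delta>)" and ?K = "KTy C (emp C) \<Delta>"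
  let ?w = "lamK E (Fs (appK C \<Delta> (qq C ?X)))"
  let ?a = "appK E (Fc \<Delta>) (qq E ?Y)" and ?i = "lamK C (idn C \<Delta>)"
  note X = C.KTy_ty[OF \<Gamma> \<Delta>] and K = C.KTy_ty[OF C.emp_con \<Delta>]
  note Y = E.KTy_ty[OF Fc_con[OF \<Gamma>] Fc_con[OF \<Delta>]]
  note FX = Ft_ty[OF X] and FK = Ft_ty[OF K]
  note w = FlamK_tm[OF \<Gamma> \<Delta>]
  note i = C.lamK_tm[OF C.idn_sub[OF \<Delta>]]
  note eps = C.eps_sub[OF \<Gamma>] C.eps_sub[OF \<Delta>]
  have q: "tm E (Fc \<Gamma> \<triangleright> ?Y) (KTy E (Fc \<Gamma> \<triangleright> ?Y) (Fc \<Delta>)) (qq E ?Y)"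
    using E.qq_tm[OF Y] by (simp add: E.KTy_sub[OF Fc_con[OF \<Delta>] E.pp_sub[OF Y]])
  have a: "sub E (Fc \<Gamma> \<triangleright> ?Y) (Fc \<Delta>) ?a"
    by (rule E.appK_sub[OF Fc_con[OF \<Delta>] q])
  have w0: "sub E (Fc (\<Gamma> \<triangleright>\<^bsub>C\<^esub> ?X)) (Fc \<Gamma> \<triangleright> ?Y) (scons E ?Y (Fs (pp C ?X)) ?w)"
    by (rule E.scons_sub[OF Fpp_sub[OF X] Y w])
  \<comment> \<open>The image of \<open>?i\<close> has the type of a constant family over \<Delta>,
    not over \<Gamma>; after reindexing the two agree because both come from the empty
    context.\<close>
  have g: "tm E (Fc \<Gamma> \<triangleright> ?Y) ((Ft ?X)\<langle>pp E ?Y\<rangle>) ((Fm ?i)\<lbrace>?a\<rbrace>)"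
    using E.tmsub_tm[OF Fm_tm[OF i] a] by (simp add: FK_tysub_unique[OF a E.pp_sub[OF Y] \<Delta> \<Gamma> \<Delta>])
  show ?thesis
    unfolding FK_def
  proof (rule lift_iso[OF X Y w g])
    have "?a \<odot> scons E ?Y (Fs (pp C ?X)) ?w = Fs (appK C \<Delta> (qq C ?X))"
      using E.appK_scomp[OF Fc_con[OF \<Delta>] q w0]
      by (simp add: E.qq_scons[OF Fpp_sub[OF X] Y w] E.appK_lamK[OF Fs_sub[OF appK_qq_sub[OF \<Gamma> \<Delta>]]])
    then have "(Fm ?i)\<lbrace>?a\<rbrace>\<lbrace>scons E ?Y (Fs (pp C ?X)) ?w\<rbrace> = Fm (?i\<lbrace>appK C \<Delta> (qq C ?X)\<rbrace>\<^bsub>C\<^esub>)"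
      using E.tmsub_scomp[OF Fm_tm[OF i] a w0] Fm_sub[OF i appK_qq_sub[OF \<Gamma> \<Delta>]] by simp
    also have "?i\<lbrace>appK C \<Delta> (qq C ?X)\<rbrace>\<^bsub>C\<^esub> = qq C ?X"
      using appK_qq_sub[OF \<Gamma> \<Delta>]
      by (simp add: C.lamK_sub[OF C.idn_sub[OF \<Delta>]] C.idn_left C.lamK_appK[OF \<Delta> K_qq_tm[OF \<Gamma> \<Delta>]])
    finally show "(Fm ?i)\<lbrace>?a\<rbrace>\<lbrace>scons E ?Y (Fs (pp C ?X)) ?w\<rbrace> = Fm (qq C ?X)" .
  next
    let ?s = "e \<Gamma> ?X \<odot> scons E (Ft ?X) (pp E ?Y) ((Fm ?i)\<lbrace>?a\<rbrace>)"
    \<comment> \<open>The substitution \<open>?s\<close> pairs p, which ends in F \<Gamma>, with a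
      term fetched from F \<Delta>, so \<open>e_scons\<close> does not apply to it directly. Both
      sides are mapped into the image of the empty context extended by \<open>?K\<close>: there F l
      composed with \<open>?s\<close> equals F c composed with \<open>?a\<close>. Eliminating the
      variable of \<open>?K\<close> by \<open>?u\<close> gives the wanted elimination on the l side
      and the identity on the c side.\<close>
    let ?l = "slift C ?K (eps C \<Gamma>)" and ?c = "scons C ?K (eps C \<Delta>) ?i"
    let ?u = "appK C \<Delta> (qq C ?K)"
    note s = E.scons_sub[OF E.pp_sub[OF Y] FX g]
    note es = E.scomp_sub[OF e_sub[OF X] s]
    note l = C.slift_sub[OF K eps(1), unfolded KTy_eps[OF \<Gamma> \<Delta>]]
    have FXK: "Ft ?X = (Ft ?K)\<langle>Fs (eps C \<Gamma>)\<rangle>"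
      using Ft_sub[OF K eps(1)] by (simp add: KTy_eps[OF \<Gamma> \<Delta>])
    have i': "tm C \<Delta> (?K\<langle>eps C \<Delta>\<rangle>\<^bsub>C\<^esub>) ?i"
      using i by (simp add: KTy_eps[OF \<Delta> \<Delta>])
    note c = C.scons_sub[OF eps(2) K i']
    note u = appK_qq_sub[OF C.emp_con \<Delta>]
    have eps_a: "Fs (eps C \<Gamma>) \<odot> pp E ?Y = Fs (eps C \<Delta>) \<odot> ?a"
      by (rule Fs_eps_unique[OF E.scomp_sub[OF Fs_sub[OF eps(1)] E.pp_sub[OF Y]]
            E.scomp_sub[OF Fs_sub[OF eps(2)] a]])
    have "Fs ?l \<odot> ?s = (e (emp C) ?K \<odot> slift E (Ft ?K) (Fs (eps C \<Gamma>))) \<odot>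
        scons E (Ft ?X) (pp E ?Y) ((Fm ?i)\<lbrace>?a\<rbrace>)"
      using E.scomp_assoc[OF Fs_sub[OF l] e_sub[OF X] s] e_slift[OF K eps(1)]
      by (simp add: KTy_eps[OF \<Gamma> \<Delta>])
    also have "\<dots> = e (emp C) ?K \<odot> scons E (Ft ?K) (Fs (eps C \<Delta>) \<odot> ?a) ((Fm ?i)\<lbrace>?a\<rbrace>)"
      using E.scomp_assoc[OF e_sub[OF K] E.slift_sub[OF FK Fs_sub[OF eps(1)]] s[unfolded FXK]]
        E.slift_scons[OF FK Fs_sub[OF eps(1)] E.pp_sub[OF Y] g[unfolded FXK]]
      by (simp add: FXK eps_a)
    finally have ls: "Fs ?l \<odot> ?s = Fs ?c \<odot> ?a"
      by (simp add: e_scons[OF eps(2) K i' a])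
    have "?u \<odot>\<^bsub>C\<^esub> ?l = appK C \<Delta> (qq C ?X)"
      using C.appK_scomp[OF \<Delta> K_qq_tm[OF C.emp_con \<Delta>] l] C.qq_slift[OF K eps(1)]
      by (simp add: KTy_eps[OF \<Gamma> \<Delta>])
    moreover have "?u \<odot>\<^bsub>C\<^esub> ?c = idn C \<Delta>"
      using C.appK_scomp[OF \<Delta> K_qq_tm[OF C.emp_con \<Delta>] c] C.appK_lamK[OF C.idn_sub[OF \<Delta>]]
      by (simp add: C.qq_scons[OF eps(2) K i'])
    ultimately have "Fs (appK C \<Delta> (qq C ?X)) \<odot> ?s = ?a"
      using E.scomp_assoc[OF Fs_sub[OF u] Fs_sub[OF l] es] E.scomp_assoc[OF Fs_sub[OF u] Fs_sub[OF c] a]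
        Fs_scomp[OF u l] Fs_scomp[OF u c] Fs_idn[OF \<Delta>] E.idn_left[OF a]
      by (simp add: ls)
    then show "?w\<lbrace>?s\<rbrace> = qq E ?Y"
      by (simp add: E.lamK_sub[OF Fs_sub[OF appK_qq_sub[OF \<Gamma> \<Delta>]] es] E.lamK_appK[OF Fc_con[OF \<Delta>] q])
  qed
qed

lemma FK_slift:
  assumes \<sigma>: "sub C \<Gamma> \<Delta> \<sigma>" and \<Theta>: "\<Theta> \<in> Con C"
  shows "(FK \<Delta> \<Theta>)\<lbrace>slift E (Ft (KTy C \<Delta> \<Theta>)) (Fs \<sigma>)\<rbrace> = FK \<Gamma> \<Theta>"
proof -
  note \<Delta> = C.sub_con(2)[OF \<sigma>]
  note X = C.KTy_ty[OF \<Delta> \<Theta>] and q = appK_qq_sub[OF \<Delta> \<Theta>]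
  note l = C.slift_sub[OF X \<sigma>]
  show ?thesis
    unfolding FK_def lift_slift[OF X FlamK_tm[OF \<Delta> \<Theta>] \<sigma>]
    by (simp add: E.lamK_sub[OF Fs_sub[OF q] Fs_sub[OF l]] C.KTy_sub[OF \<Theta> \<sigma>] C.qq_slift[OF X \<sigma>]
        flip: Fs_scomp[OF q l] C.appK_scomp[OF \<Theta> K_qq_tm[OF \<Delta> \<Theta>] l])
qed

lemma tyact_FK:
  assumes \<Delta>: "\<Delta> \<in> Con C" and t: "tm C \<Gamma> (KTy C \<Gamma> \<Delta>) t"
  shows "tyact E (Fc \<Gamma>) (Ft (KTy C \<Gamma> \<Delta>)) (FK \<Gamma> \<Delta>) (Fm t) = lamK E (Fs (appK C \<Delta> t))"
proof -
  note \<Gamma> = C.ty_con[OF C.tm_ty[OF t]]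
  note q = appK_qq_sub[OF \<Gamma> \<Delta>] and s = C.sinst_sub[OF t]
  show ?thesis
    unfolding FK_def tyact_lift[OF t FlamK_tm[OF \<Gamma> \<Delta>]]
    by (simp add: E.lamK_sub[OF Fs_sub[OF q] Fs_sub[OF s]] C.qq_sinst[OF t]
        flip: Fs_scomp[OF q s] C.appK_scomp[OF \<Delta> K_qq_tm[OF \<Gamma> \<Delta>] s])
qed

subsection \<open>Preservation of identity types\<close>

text \<open>Over the extension by the identity type the two endpoints are equal by reflection, so
  reflexivity at t also inhabits the identity type from t to u.\<close>

definition FId :: "'c \<Rightarrow> 't \<Rightarrow> 'm \<Rightarrow> 'm \<Rightarrow> 'n" where
  "FId \<Gamma> A t u = lift \<Gamma> (IdTy C A t u) (rfl E (Fm (t\<lbrace>pp C (IdTy C A t u)\<rbrace>\<^bsub>C\<^esub>)))"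

context
  fixes \<Gamma> A t u
  assumes t: "tm C \<Gamma> A t" and u: "tm C \<Gamma> A u"
begin

lemma Id_pp_eq: "t\<lbrace>pp C (IdTy C A t u)\<rbrace>\<^bsub>C\<^esub> = u\<lbrace>pp C (IdTy C A t u)\<rbrace>\<^bsub>C\<^esub>"
proof -
  note X = C.IdTy_ty[OF t u]
  note p = C.pp_sub[OF X]
  show ?thesis
    using C.Id_reflection[OF C.tmsub_tm[OF t p] C.tmsub_tm[OF u p]] C.qq_tm[OF X]
    by (simp add: C.IdTy_sub[OF t u p])
qed

text \<open>By UIP the generic proof is reflexivity. This yields both one inverse law and
  verticality.\<close>

lemma Id_pp_rfl: "rfl C (t\<lbrace>pp C (IdTy C A t u)\<rbrace>\<^bsub>C\<^esub>) = qq C (IdTy C A t u)"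
proof -
  note X = C.IdTy_ty[OF t u]
  note p = C.pp_sub[OF X]
  show ?thesis
    using C.Id_UIP[OF C.tmsub_tm[OF t p] C.tmsub_tm[OF u p]] C.qq_tm[OF X] C.rfl_tm[OF C.tmsub_tm[OF t p]]
    by (simp add: C.IdTy_sub[OF t u p] Id_pp_eq)
qed

lemma Frfl_tm:
  "tm E (Fc (\<Gamma> \<triangleright>\<^bsub>C\<^esub> IdTy C A t u)) ((IdTy E (Ft A) (Fm t) (Fm u))\<langle>Fs (pp C (IdTy C A t u))\<rangle>)
    (rfl E (Fm (t\<lbrace>pp C (IdTy C A t u)\<rbrace>\<^bsub>C\<^esub>)))"
proof -
  note p = C.pp_sub[OF C.IdTy_ty[OF t u]]
  show ?thesis
    using E.rfl_tm[OF Fm_tm[OF C.tmsub_tm[OF t p]]] Id_pp_eq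
    by (simp add: E.IdTy_sub[OF Fm_tm[OF t] Fm_tm[OF u] Fs_sub[OF p]] Ft_sub[OF C.tm_ty[OF t] p]
        flip: Fm_sub[OF t p] Fm_sub[OF u p])
qed

text \<open>The equation \<open>eq\<close> holds in E only, so F cannot be applied to it. Over
  \<Gamma> \<triangleright> A let V be the identity type from t to the variable. For v among t and
  u, the image of Id A t v reindexed along \<rho> is F V along a substitution that depends on v only
  through F v reindexed along \<rho>, and there \<open>eq\<close> applies.\<close>

lemma FId_tysub:
  assumes \<rho>: "sub E \<Xi> (Fc \<Gamma>) \<rho>" and eq: "(Fm t)\<lbrace>\<rho>\<rbrace> = (Fm u)\<lbrace>\<rho>\<rbrace>"
  shows "(Ft (IdTy C A t t))\<langle>\<rho>\<rangle> = (Ft (IdTy C A t u))\<langle>\<rho>\<rangle>"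
proof -
  note A = C.tm_ty[OF t]
  note p = C.pp_sub[OF A]
  let ?V = "IdTy C (A\<langle>pp C A\<rangle>\<^bsub>C\<^esub>) (t\<lbrace>pp C A\<rbrace>\<^bsub>C\<^esub>) (qq C A)"
  note V = C.IdTy_ty[OF C.tmsub_tm[OF t p] C.qq_tm[OF A]]
  have *: "(Ft (IdTy C A t v))\<langle>\<rho>\<rangle> = (Ft ?V)\<langle>e \<Gamma> A \<odot> scons E (Ft A) \<rho> ((Fm v)\<lbrace>\<rho>\<rbrace>)\<rangle>"
    if v: "tm C \<Gamma> A v" for v
  proof -
    note s = C.sinst_sub[OF v]
    have "?V\<langle>sinst C \<Gamma> A v\<rangle>\<^bsub>C\<^esub> = IdTy C A t v"
      using C.tysub_scomp[OF A p s] C.tmsub_scomp[OF t p s]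
      by (simp add: C.IdTy_sub[OF C.tmsub_tm[OF t p] C.qq_tm[OF A] s] C.qq_sinst[OF v] C.pp_sinst[OF v]
          C.tysub_idn[OF A] C.tmsub_idn[OF t])
    then have "(Ft (IdTy C A t v))\<langle>\<rho>\<rangle> = (Ft ?V)\<langle>Fs (sinst C \<Gamma> A v) \<odot> \<rho>\<rangle>"
      using Ft_sub[OF V s] E.tysub_scomp[OF Ft_ty[OF V] Fs_sub[OF s] \<rho>] by simp
    then show ?thesis
      using e_scons[OF C.idn_sub[OF C.ty_con[OF A]] A C.sinst_tm[OF v] \<rho>]
      by (simp add: sinst_def Fs_idn[OF C.ty_con[OF A]] E.idn_left[OF \<rho>])
  qed
  show ?thesis by (simp add: *[OF t] *[OF u] eq)
qed

lemma FId_iso: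
  "ty_iso E (Fc \<Gamma>) (Ft (IdTy C A t u)) (IdTy E (Ft A) (Fm t) (Fm u)) (FId \<Gamma> A t u)"
proof -
  let ?X = "IdTy C A t u" and ?Y = "IdTy E (Ft A) (Fm t) (Fm u)"
  let ?p = "pp C ?X" and ?P = "pp E ?Y"
  let ?w = "rfl E (Fm (t\<lbrace>?p\<rbrace>\<^bsub>C\<^esub>))"
  note Ft = Fm_tm[OF t] and Fu = Fm_tm[OF u]
  note X = C.IdTy_ty[OF t u] and Y = E.IdTy_ty[OF Ft Fu]
  note p = C.pp_sub[OF X] and P = E.pp_sub[OF Y]
  note w = Frfl_tm and r = C.rfl_tm[OF t]
  note tP = E.tmsub_tm[OF Ft P] and uP = E.tmsub_tm[OF Fu P]
  have q: "tm E (Fc \<Gamma> \<triangleright> ?Y) (IdTy E ((Ft A)\<langle>?P\<rangle>) ((Fm t)\<lbrace>?P\<rbrace>) ((Fm u)\<lbrace>?P\<rbrace>)) (qq E ?Y)"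
    using E.qq_tm[OF Y] by (simp add: E.IdTy_sub[OF Ft Fu P])
  \<comment> \<open>Reflection in E, applied to the generic proof of \<open>?Y\<close>, supplies the
    equation between the reindexed endpoints.\<close>
  have g: "tm E (Fc \<Gamma> \<triangleright> ?Y) ((Ft ?X)\<langle>?P\<rangle>) ((Fm (rfl C t))\<lbrace>?P\<rbrace>)"
    using E.tmsub_tm[OF Fm_tm[OF r] P] FId_tysub[OF P E.Id_reflection[OF tP uP q]] by simp
  show ?thesis
    unfolding FId_def
  proof (rule lift_iso[OF X Y w g])
    show "(Fm (rfl C t))\<lbrace>?P\<rbrace>\<lbrace>scons E ?Y (Fs ?p) ?w\<rbrace> = Fm (qq C ?X)"
      using E.tmsub_scomp[OF Fm_tm[OF r] P E.scons_sub[OF Fpp_sub[OF X] Y w]] Fm_sub[OF r p]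
      by (simp add: E.pp_scons[OF Fpp_sub[OF X] Y w] C.rfl_sub[OF t p] Id_pp_rfl)
    let ?s = "scons E (Ft ?X) ?P ((Fm (rfl C t))\<lbrace>?P\<rbrace>)"
    have s: "sub E (Fc \<Gamma> \<triangleright> ?Y) (Fc \<Gamma> \<triangleright> Ft ?X) ?s"
      by (rule E.scons_sub[OF P Ft_ty[OF X] g])
    have "Fs ?p \<odot> (e \<Gamma> ?X \<odot> ?s) = ?P"
      using E.scomp_assoc[OF Fpp_sub[OF X] e_sub[OF X] s]
      by (simp add: Fpp_e[OF X] E.pp_scons[OF P Ft_ty[OF X] g])
    then have "tm E (Fc \<Gamma> \<triangleright> ?Y) (?Y\<langle>?P\<rangle>) (?w\<lbrace>e \<Gamma> ?X \<odot> ?s\<rbrace>)"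
      using E.tmsub_scomp_tm[OF w Y Fpp_sub[OF X] E.scomp_sub[OF e_sub[OF X] s]] by simp
    \<comment> \<open>Only the typing of the left-hand side matters: any two proofs of the same
      identity are equal.\<close>
    then show "?w\<lbrace>e \<Gamma> ?X \<odot> ?s\<rbrace> = qq E ?Y"
      using E.Id_UIP[OF tP uP _ q] by (simp add: E.IdTy_sub[OF Ft Fu P])
  qed
qed

lemma FId_slift:
  assumes \<sigma>: "sub C \<Delta> \<Gamma> \<sigma>"
  shows "(FId \<Gamma> A t u)\<lbrace>slift E (Ft (IdTy C A t u)) (Fs \<sigma>)\<rbrace> =
    FId \<Delta> (A\<langle>\<sigma>\<rangle>\<^bsub>C\<^esub>) (t\<lbrace>\<sigma>\<rbrace>\<^bsub>C\<^esub>) (u\<lbrace>\<sigma>\<rbrace>\<^bsub>C\<^esub>)"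
proof -
  note X = C.IdTy_ty[OF t u]
  note l = C.slift_sub[OF X \<sigma>] and p = C.pp_sub[OF X]
  note p' = C.pp_sub[OF C.tysub_ty[OF X \<sigma>]]
  show ?thesis
    unfolding FId_def lift_slift[OF X Frfl_tm \<sigma>]
    using C.tmsub_scomp[OF t p l] C.tmsub_scomp[OF t \<sigma> p']
    by (simp add: E.rfl_sub[OF Fm_tm[OF C.tmsub_tm[OF t p]] Fs_sub[OF l]] C.pp_slift[OF X \<sigma>]
        flip: Fm_sub[OF C.tmsub_tm[OF t p] l] C.IdTy_sub[OF t u \<sigma>])
qed

end

lemma tyact_FId:
  assumes t: "tm C \<Gamma> A t"
  shows "tyact E (Fc \<Gamma>) (Ft (IdTy C A t t)) (FId \<Gamma> A t t) (Fm (rfl C t)) = rfl E (Fm t)"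
proof -
  note r = C.rfl_tm[OF t] and p = C.pp_sub[OF C.IdTy_ty[OF t t]]
  note s = C.sinst_sub[OF r]
  show ?thesis
    unfolding FId_def tyact_lift[OF r Frfl_tm[OF t t]]
    using C.tmsub_scomp[OF t p s]
    by (simp add: E.rfl_sub[OF Fm_tm[OF C.tmsub_tm[OF t p]] Fs_sub[OF s]] C.pp_sinst[OF r]
        C.tmsub_idn[OF t] flip: Fm_sub[OF C.tmsub_tm[OF t p] s])
qed

end

subsection \<open>Weak sections as weak morphisms\<close>

text \<open>Only the forward map needs its first component checked: the base part of the inverse is
  existentially quantified in \<open>dty_iso\<close>, and the total inverse laws supply its
  equations.\<close>

lemma vertical_ty_iso_total:
  "ty_iso (total C D) (\<Gamma>\<^sub>0, \<Gamma>) (A\<^sub>0, A) (A\<^sub>0, B) f \<Longrightarrow> fst f = qq C A\<^sub>0 \<Longrightarrow>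
    vertical_ty_iso C D \<Gamma>\<^sub>0 A\<^sub>0 \<Gamma> A B (snd f)"
  by (fastforce simp: ty_iso_def ty_mor_def vertical_ty_iso_def dty_iso_def dty_mor_def)

context weak_flCwF_section
begin

text \<open>The context is an argument because the identity in the first component depends on it,
  while A alone need not determine it.\<close>

abbreviation ext_inv :: "'c \<Rightarrow> 't \<Rightarrow> 's \<times> 'ds" where
  "ext_inv \<Gamma> A \<equiv> (idn C (\<Gamma> \<triangleright>\<^bsub>C\<^esub> A), sext_inv S A)"

sublocale M: weak_flCwF_morphism C "total C D"
  "\<lambda>\<Gamma>. (\<Gamma>, scon S \<Gamma>)" "\<lambda>\<sigma>. (\<sigma>, ssub S \<sigma>)" "\<lambda>A. (A, sty S A)" "\<lambda>t. (t, stm S t)"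
  "(idn C (emp C), semp S)" ext_inv
proof (intro weak_flCwF_morphism.intro flCwF_axioms flCwF_total weak_flCwF_morphism_axioms.intro)
  \<comment> \<open>In the base the comparison map of the empty context is the identity by
    terminality, so the identity can be the first component of its retraction.\<close>
  have "idn C (emp C) = eps C (emp C)"
    by (rule eps_unique[OF idn_sub[OF emp_con]])
  then show "(idn C (emp C), semp S) \<odot>\<^bsub>total C D\<^esub> eps (total C D) (emp C, scon S (emp C)) =
      idn (total C D) (emp C, scon S (emp C))"
    using idn_left[OF idn_sub[OF emp_con]] by (simp add: semp_eps)
qed (simp_all add: scon_dcon ssub_dsub sty_dty stm_dtm ssub_idn ssub_scomp sty_sub stm_sub semp_dsub
    sext_inv_dsub sext_inv_left sext_inv_right scons_pp_qq idn_left[OF idn_sub] cext_con)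

text \<open>First components compute in C, where F and \<open>e\<close> act as identities. What
  remains is the generic element eliminated and reintroduced, which is q by eta; for K the same
  argument uses \<open>lamK_appK\<close>, and for Id UIP takes the place of eta.\<close>

lemma fst_FSig:
  assumes A: "ty C \<Gamma> A" and B: "ty C (\<Gamma> \<triangleright>\<^bsub>C\<^esub> A) B"
  shows "fst (M.FSig \<Gamma> A B) = qq C (SigTy C A B)"
proof -
  note X = SigTy_ty[OF A B]
  show ?thesis
    using spair_sproj[OF A B pp_sub[OF X] qq_tm[OF X]]
    by (simp add: M.FSig_def M.lift_def M.Fpair_def spair_def sproj1_def sproj2_def tysub_idn[OF B]
        tmsub_idn[OF qq_tm[OF X]])
qed

lemma fst_FK:
  assumes "\<Gamma> \<in> Con C" "\<Delta> \<in> Con C"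
  shows "fst (M.FK \<Gamma> \<Delta>) = qq C (KTy C \<Gamma> \<Delta>)"
  using M.K_qq_tm[OF assms] assms(2)
  by (simp add: M.FK_def M.lift_def lamK_appK tmsub_idn)

lemma fst_FId:
  assumes t: "tm C \<Gamma> A t" and u: "tm C \<Gamma> A u"
  shows "fst (M.FId \<Gamma> A t u) = qq C (IdTy C A t u)"
  by (simp add: M.FId_def M.lift_def M.Id_pp_rfl[OF t u] tmsub_idn[OF qq_tm[OF IdTy_ty[OF t u]]])

end

theorem theorem3:
  fixes C :: "('c,'s,'t,'m) flcwf"
    and D :: "('c,'s,'t,'m,'dc,'ds,'dt,'dm) iso_cleaving" (structure)
    and S :: "('c,'s,'t,'m,'dc,'ds,'dt,'dm) weak_section"
  assumes "flCwF C"
    and "split_flCwF_isofibration C D"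
    and "weak_flCwF_section C D S"
  shows "\<exists>(s\<Sigma> :: 'c \<Rightarrow> 't \<Rightarrow> 't \<Rightarrow> 'dm) (sK :: 'c \<Rightarrow> 'c \<Rightarrow> 'dm) (sId :: 'c \<Rightarrow> 't \<Rightarrow> 'm \<Rightarrow> 'm \<Rightarrow> 'dm).
    (\<forall>\<Gamma> A B. ty C \<Gamma> A \<longrightarrow> ty C (\<Gamma> \<triangleright>\<^bsub>C\<^esub> A) B \<longrightarrow>
       vertical_ty_iso C D \<Gamma> (SigTy C A B) (scon S \<Gamma>)
         (sty S (SigTy C A B)) (SigTy D (sty S A) ((sty S B)\<langle>sext_inv S A\<rangle>)) (s\<Sigma> \<Gamma> A B)) \<and>
    (\<forall>\<Gamma> \<Delta>. \<Gamma> \<in> Con C \<longrightarrow> \<Delta> \<in> Con C \<longrightarrow>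
       vertical_ty_iso C D \<Gamma> (KTy C \<Gamma> \<Delta>) (scon S \<Gamma>)
         (sty S (KTy C \<Gamma> \<Delta>)) (KTy D (scon S \<Gamma>) (scon S \<Delta>)) (sK \<Gamma> \<Delta>)) \<and>
    (\<forall>\<Gamma> A t u. tm C \<Gamma> A t \<longrightarrow> tm C \<Gamma> A u \<longrightarrow>
       vertical_ty_iso C D \<Gamma> (IdTy C A t u) (scon S \<Gamma>)
         (sty S (IdTy C A t u)) (IdTy D (sty S A) (stm S t) (stm S u)) (sId \<Gamma> A t u)) \<and>
    (\<forall>\<Gamma> \<Delta> \<sigma> A B. sub C \<Gamma> \<Delta> \<sigma> \<longrightarrow> ty C \<Delta> A \<longrightarrow> ty C (\<Delta> \<triangleright>\<^bsub>C\<^esub> A) B \<longrightarrow>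
       (s\<Sigma> \<Delta> A B)\<lbrace>slift D (sty S (SigTy C A B)) (ssub S \<sigma>)\<rbrace> =
       s\<Sigma> \<Gamma> (A\<langle>\<sigma>\<rangle>\<^bsub>C\<^esub>) (B\<langle>slift C A \<sigma>\<rangle>\<^bsub>C\<^esub>)) \<and>
    (\<forall>\<Gamma> \<Delta> \<Theta> \<sigma>. sub C \<Gamma> \<Delta> \<sigma> \<longrightarrow> \<Theta> \<in> Con C \<longrightarrow>
       (sK \<Delta> \<Theta>)\<lbrace>slift D (sty S (KTy C \<Delta> \<Theta>)) (ssub S \<sigma>)\<rbrace> = sK \<Gamma> \<Theta>) \<and>
    (\<forall>\<Gamma> \<Delta> \<sigma> A t u. sub C \<Gamma> \<Delta> \<sigma> \<longrightarrow> tm C \<Delta> A t \<longrightarrow> tm C \<Delta> A u \<longrightarrow>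
       (sId \<Delta> A t u)\<lbrace>slift D (sty S (IdTy C A t u)) (ssub S \<sigma>)\<rbrace> =
       sId \<Gamma> (A\<langle>\<sigma>\<rangle>\<^bsub>C\<^esub>) (t\<lbrace>\<sigma>\<rbrace>\<^bsub>C\<^esub>) (u\<lbrace>\<sigma>\<rbrace>\<^bsub>C\<^esub>)) \<and>
    (\<forall>\<Gamma> A B t u. ty C (\<Gamma> \<triangleright>\<^bsub>C\<^esub> A) B \<longrightarrow> tm C \<Gamma> A t \<longrightarrow> tm C \<Gamma> (B\<langle>sinst C \<Gamma> A t\<rangle>\<^bsub>C\<^esub>) u \<longrightarrow>
       tyact D (scon S \<Gamma>) (sty S (SigTy C A B)) (s\<Sigma> \<Gamma> A B) (stm S (sgpair C A B t u)) =
       sgpair D (sty S A) ((sty S B)\<langle>sext_inv S A\<rangle>) (stm S t) (stm S u)) \<and>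
    (\<forall>\<Gamma> A B t. ty C \<Gamma> A \<longrightarrow> ty C (\<Gamma> \<triangleright>\<^bsub>C\<^esub> A) B \<longrightarrow> tm C \<Gamma> (SigTy C A B) t \<longrightarrow>
       stm S (proj1 C A B t) =
         proj1 D (sty S A) ((sty S B)\<langle>sext_inv S A\<rangle>)
           (tyact D (scon S \<Gamma>) (sty S (SigTy C A B)) (s\<Sigma> \<Gamma> A B) (stm S t)) \<and>
       stm S (proj2 C A B t) =
         proj2 D (sty S A) ((sty S B)\<langle>sext_inv S A\<rangle>)
           (tyact D (scon S \<Gamma>) (sty S (SigTy C A B)) (s\<Sigma> \<Gamma> A B) (stm S t))) \<and>
    (\<forall>\<Gamma> A t. tm C \<Gamma> A t \<longrightarrow>
       tyact D (scon S \<Gamma>) (sty S (IdTy C A t t)) (sId \<Gamma> A t t) (stm S (rfl C t)) =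
       rfl D (stm S t)) \<and>
    (\<forall>\<Gamma> \<Delta> \<sigma>. sub C \<Gamma> \<Delta> \<sigma> \<longrightarrow>
       tyact D (scon S \<Gamma>) (sty S (KTy C \<Gamma> \<Delta>)) (sK \<Gamma> \<Delta>) (stm S (lamK C \<sigma>)) =
       lamK D (ssub S \<sigma>)) \<and>
    (\<forall>\<Gamma> \<Delta> t. \<Delta> \<in> Con C \<longrightarrow> tm C \<Gamma> (KTy C \<Gamma> \<Delta>) t \<longrightarrow>
       ssub S (appK C \<Delta> t) =
       appK D (scon S \<Delta>)
         (tyact D (scon S \<Gamma>) (sty S (KTy C \<Gamma> \<Delta>)) (sK \<Gamma> \<Delta>) (stm S t)))"
proof -
  interpret weak_flCwF_section C D S by fact
  let ?Sig = "\<lambda>\<Gamma> A B. snd (M.FSig \<Gamma> A B)" and ?K = "\<lambda>\<Gamma> \<Delta>. snd (M.FK \<Gamma> \<Delta>)"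
    and ?Id = "\<lambda>\<Gamma> A t u. snd (M.FId \<Gamma> A t u)"
  \<comment> \<open>Equations in the total flCwF split into components; the second components are
    the displayed claims.\<close>
  note [simp] = prod_eq_iff
  show ?thesis
  proof (intro exI[of _ ?Sig] exI[of _ ?K] exI[of _ ?Id] conjI allI impI)
    fix \<Gamma> A B assume "ty C \<Gamma> A" "ty C (\<Gamma> \<triangleright>\<^bsub>C\<^esub> A) B"
    then show "vertical_ty_iso C D \<Gamma> (SigTy C A B) (scon S \<Gamma>)
         (sty S (SigTy C A B)) (SigTy D (sty S A) ((sty S B)\<langle>sext_inv S A\<rangle>)) (?Sig \<Gamma> A B)"
      \<comment> \<open>The base part of the target is Sigma of A and B reindexed along the
        identity; \<open>tysub_idn\<close> identifies it with the base part of the source, as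
        verticality requires.\<close>
      using M.FSig_iso[of \<Gamma> A B] tysub_idn[of "\<Gamma> \<triangleright>\<^bsub>C\<^esub> A" B]
      by (intro vertical_ty_iso_total) (simp_all del: prod_eq_iff add: fst_FSig)
  next
    fix \<Gamma> \<Delta> assume "\<Gamma> \<in> Con C" "\<Delta> \<in> Con C"
    then show "vertical_ty_iso C D \<Gamma> (KTy C \<Gamma> \<Delta>) (scon S \<Gamma>)
         (sty S (KTy C \<Gamma> \<Delta>)) (KTy D (scon S \<Gamma>) (scon S \<Delta>)) (?K \<Gamma> \<Delta>)"
      using M.FK_iso[of \<Gamma> \<Delta>]
      by (intro vertical_ty_iso_total) (simp_all del: prod_eq_iff add: fst_FK)
  next
    fix \<Gamma> A t u assume "tm C \<Gamma> A t" "tm C \<Gamma> A u"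
    then show "vertical_ty_iso C D \<Gamma> (IdTy C A t u) (scon S \<Gamma>)
         (sty S (IdTy C A t u)) (IdTy D (sty S A) (stm S t) (stm S u)) (?Id \<Gamma> A t u)"
      using M.FId_iso[of \<Gamma> A t u]
      by (intro vertical_ty_iso_total) (simp_all del: prod_eq_iff add: fst_FId)
  next
    fix \<Gamma> \<Delta> \<sigma> A B assume "sub C \<Gamma> \<Delta> \<sigma>" "ty C \<Delta> A" "ty C (\<Delta> \<triangleright>\<^bsub>C\<^esub> A) B"
    then show "(?Sig \<Delta> A B)\<lbrace>slift D (sty S (SigTy C A B)) (ssub S \<sigma>)\<rbrace> =
       ?Sig \<Gamma> (A\<langle>\<sigma>\<rangle>\<^bsub>C\<^esub>) (B\<langle>slift C A \<sigma>\<rangle>\<^bsub>C\<^esub>)"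
      using M.FSig_slift[of \<Gamma> \<Delta> \<sigma> A B] by simp
  next
    fix \<Gamma> \<Delta> \<Theta> \<sigma> assume "sub C \<Gamma> \<Delta> \<sigma>" "\<Theta> \<in> Con C"
    then show "(?K \<Delta> \<Theta>)\<lbrace>slift D (sty S (KTy C \<Delta> \<Theta>)) (ssub S \<sigma>)\<rbrace> = ?K \<Gamma> \<Theta>"
      using M.FK_slift[of \<Gamma> \<Delta> \<sigma> \<Theta>] by simp
  next
    fix \<Gamma> \<Delta> \<sigma> A t u assume "sub C \<Gamma> \<Delta> \<sigma>" "tm C \<Delta> A t" "tm C \<Delta> A u"
    then show "(?Id \<Delta> A t u)\<lbrace>slift D (sty S (IdTy C A t u)) (ssub S \<sigma>)\<rbrace> =
       ?Id \<Gamma> (A\<langle>\<sigma>\<rangle>\<^bsub>C\<^esub>) (t\<lbrace>\<sigma>\<rbrace>\<^bsub>C\<^esub>) (u\<lbrace>\<sigma>\<rbrace>\<^bsub>C\<^esub>)"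
      using M.FId_slift[of \<Delta> A t u \<Gamma> \<sigma>] by simp
  next
    fix \<Gamma> A B t u
    assume B: "ty C (\<Gamma> \<triangleright>\<^bsub>C\<^esub> A) B" and t: "tm C \<Gamma> A t" and u: "tm C \<Gamma> (B\<langle>sinst C \<Gamma> A t\<rangle>\<^bsub>C\<^esub>) u"
    show "tyact D (scon S \<Gamma>) (sty S (SigTy C A B)) (?Sig \<Gamma> A B) (stm S (sgpair C A B t u)) =
       sgpair D (sty S A) ((sty S B)\<langle>sext_inv S A\<rangle>) (stm S t) (stm S u)"
      using M.tyact_FSig[OF tm_ty[OF t] B sgpair_tm[OF B t u]]
      by (simp add: proj1_sgpair[OF B t u] proj2_sgpair[OF B t u])
  next
    fix \<Gamma> A B t assume H: "ty C \<Gamma> A" "ty C (\<Gamma> \<triangleright>\<^bsub>C\<^esub> A) B" "tm C \<Gamma> (SigTy C A B) t"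
    let ?t = "tyact D (scon S \<Gamma>) (sty S (SigTy C A B)) (?Sig \<Gamma> A B) (stm S t)"
    show "stm S (proj1 C A B t) = proj1 D (sty S A) ((sty S B)\<langle>sext_inv S A\<rangle>) ?t"
      and "stm S (proj2 C A B t) = proj2 D (sty S A) ((sty S B)\<langle>sext_inv S A\<rangle>) ?t"
      using M.proj_tyact_FSig[OF H] by simp_all
  next
    fix \<Gamma> A t assume "tm C \<Gamma> A t"
    then show "tyact D (scon S \<Gamma>) (sty S (IdTy C A t t)) (?Id \<Gamma> A t t) (stm S (rfl C t)) =
       rfl D (stm S t)"
      using M.tyact_FId[of \<Gamma> A t] by simp
  next
    fix \<Gamma> \<Delta> \<sigma> assume \<sigma>: "sub C \<Gamma> \<Delta> \<sigma>"
    show "tyact D (scon S \<Gamma>) (sty S (KTy C \<Gamma> \<Delta>)) (?K \<Gamma> \<Delta>) (stm S (lamK C \<sigma>)) =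
       lamK D (ssub S \<sigma>)"
      using M.tyact_FK[OF sub_con(2)[OF \<sigma>] lamK_tm[OF \<sigma>]] by (simp add: appK_lamK[OF \<sigma>])
  next
    fix \<Gamma> \<Delta> t assume "\<Delta> \<in> Con C" "tm C \<Gamma> (KTy C \<Gamma> \<Delta>) t"
    then show "ssub S (appK C \<Delta> t) =
       appK D (scon S \<Delta>) (tyact D (scon S \<Gamma>) (sty S (KTy C \<Gamma> \<Delta>)) (?K \<Gamma> \<Delta>) (stm S t))"
      \<comment> \<open>The action on the image of t is \<open>lamK\<close> of the image of its
        elimination, and \<open>appK\<close> undoes that \<open>lamK\<close>.\<close>
      using M.tyact_FK[of \<Delta> \<Gamma> t] d_appK_lamK[OF ssub_dsub[OF appK_sub]] by simp
  qed
qed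

end
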